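(* Let $(X_n)_{n\in\mathbb Z}$ and $(Y_n)_{n\in\mathbb Z}$ be stationary centered Gaussian Markovian real processes with absolutely continuous finite-dimensional distributions and with the same $L^2$ norm ($\|X_0\|_2=\|Y_0\|_2$). Then they have the same Shannon entropy if and only if either $(X_n)$ and $(Y_n)$ have the same law, or $(Y_n)$ and $((-1)^nX_n)$ have the same law.
   Context: For a stationary real process $(X_n)$ with finite-dimensional laws absolutely continuous with respect to Lebesgue measure, let $\rho_n$ be the density of the law of $(X_0,\dots,X_{n-1})$ on $\mathbb R^n$ and $H_n=-\int_{\mathbb R^n}\rho_n\log\rho_n\,dl^n$, where $l^n$ is Lebesgue measure. The Shannon entropy of the process is $\lim_n\frac1nH_n\in[-\infty,\infty)$ (for $X_0\in L^2$ the limit exists). *)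

theory Defs
  imports "HOL-Probability.Probability"
begin

text \<open>A two-sided real process on a probability space \<open>M\<close> is a family
  \<open>X :: int \<Rightarrow> 'a \<Rightarrow> real\<close> of random variables; its law lives on the product space
  of real sequences indexed by \<open>int\<close>.\<close>

definition real_process :: "'a measure \<Rightarrow> (int \<Rightarrow> 'a \<Rightarrow> real) \<Rightarrow> bool" where
  "real_process M X \<longleftrightarrow> prob_space M \<and> (\<forall>n. X n \<in> borel_measurable M)"

definition process_law :: "'a measure \<Rightarrow> (int \<Rightarrow> 'a \<Rightarrow> real) \<Rightarrow> (int \<Rightarrow> real) measure" where
  "process_law M X = distr M (Pi\<^sub>M UNIV (\<lambda>_. borel)) (\<lambda>\<omega> n. X n \<omega>)"

definition marginal_law ::
    "'a measure \<Rightarrow> (int \<Rightarrow> 'a \<Rightarrow> real) \<Rightarrow> int set \<Rightarrow> (int \<Rightarrow> real) measure" where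
  "marginal_law M X J = distr M (Pi\<^sub>M J (\<lambda>_. borel)) (\<lambda>\<omega>. \<lambda>j\<in>J. X j \<omega>)"

definition stationary :: "'a measure \<Rightarrow> (int \<Rightarrow> 'a \<Rightarrow> real) \<Rightarrow> bool" where
  "stationary M X \<longleftrightarrow> (\<forall>k. process_law M (\<lambda>n. X (n + k)) = process_law M X)"

definition centered :: "'a measure \<Rightarrow> (int \<Rightarrow> 'a \<Rightarrow> real) \<Rightarrow> bool" where
  "centered M X \<longleftrightarrow> (\<forall>n. integrable M (X n) \<and> (\<integral>\<omega>. X n \<omega> \<partial>M) = 0)"

text \<open>Point masses count as (degenerate) Gaussian laws, so that the zero linear
  combination is Gaussian.\<close>

definition gaussian_law :: "real measure \<Rightarrow> bool" where
  "gaussian_law \<mu> \<longleftrightarrow>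
     (\<exists>m. \<mu> = return borel m) \<or> (\<exists>m \<sigma>. \<sigma> > 0 \<and> \<mu> = density lborel (normal_density m \<sigma>))"

definition gaussian_process :: "'a measure \<Rightarrow> (int \<Rightarrow> 'a \<Rightarrow> real) \<Rightarrow> bool" where
  "gaussian_process M X \<longleftrightarrow>
     (\<forall>J a. finite J \<longrightarrow> gaussian_law (distr M borel (\<lambda>\<omega>. \<Sum>j\<in>J. a j * X j \<omega>)))"

definition generated_algebra ::
    "'a measure \<Rightarrow> (int \<Rightarrow> 'a \<Rightarrow> real) \<Rightarrow> int set \<Rightarrow> 'a measure" where
  "generated_algebra M X J =
     vimage_algebra (space M) (\<lambda>\<omega>. \<lambda>j\<in>J. X j \<omega>) (Pi\<^sub>M J (\<lambda>_. borel))"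

definition markovian :: "'a measure \<Rightarrow> (int \<Rightarrow> 'a \<Rightarrow> real) \<Rightarrow> bool" where
  "markovian M X \<longleftrightarrow>
     (\<forall>s t. s < t \<longrightarrow> (\<forall>B \<in> sets borel. AE \<omega> in M.
        real_cond_exp M (generated_algebra M X {..s}) (\<lambda>\<omega>. indicator B (X t \<omega>)) \<omega> =
        real_cond_exp M (generated_algebra M X {s}) (\<lambda>\<omega>. indicator B (X t \<omega>)) \<omega>))"

definition abs_continuous_marginals :: "'a measure \<Rightarrow> (int \<Rightarrow> 'a \<Rightarrow> real) \<Rightarrow> bool" where
  "abs_continuous_marginals M X \<longleftrightarrow>
     (\<forall>J. finite J \<longrightarrow> absolutely_continuous (Pi\<^sub>M J (\<lambda>_. lborel)) (marginal_law M X J))"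

definition L2_norm :: "'a measure \<Rightarrow> ('a \<Rightarrow> real) \<Rightarrow> real" where
  "L2_norm M f = sqrt (\<integral>\<omega>. (f \<omega>)\<^sup>2 \<partial>M)"

definition block_density ::
    "'a measure \<Rightarrow> (int \<Rightarrow> 'a \<Rightarrow> real) \<Rightarrow> nat \<Rightarrow> (int \<Rightarrow> real) \<Rightarrow> real" where
  "block_density M X n x =
     enn2real (RN_deriv (Pi\<^sub>M {0..<int n} (\<lambda>_. lborel)) (marginal_law M X {0..<int n}) x)"

text \<open>The integral of \<open>- \<rho> ln \<rho>\<close> may be \<open>- \<infinity>\<close>, so it is taken as the difference of the
  integrals of its positive and negative parts (\<open>ennreal\<close> truncates negative reals to \<open>0\<close>).
  The former is finite when \<open>X 0\<close> is square integrable. Points with \<open>\<rho> = 0\<close>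
  contribute \<open>0\<close>.\<close>

definition block_entropy :: "'a measure \<Rightarrow> (int \<Rightarrow> 'a \<Rightarrow> real) \<Rightarrow> nat \<Rightarrow> ereal" where
  "block_entropy M X n =
     enn2ereal (\<integral>\<^sup>+ x. ennreal (- (block_density M X n x * ln (block_density M X n x)))
                  \<partial>Pi\<^sub>M {0..<int n} (\<lambda>_. lborel))
   - enn2ereal (\<integral>\<^sup>+ x. ennreal (block_density M X n x * ln (block_density M X n x))
                  \<partial>Pi\<^sub>M {0..<int n} (\<lambda>_. lborel))"

definition shannon_entropy :: "'a measure \<Rightarrow> (int \<Rightarrow> 'a \<Rightarrow> real) \<Rightarrow> ereal" where
  "shannon_entropy M X = lim (\<lambda>n. block_entropy M X n / ereal (real n))"

end

theory Submission
  imports Defs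
begin

text \<open>A stationary centered Gaussian Markov process with nondegenerate marginals has covariance
  \<open>s\<^sup>2 r^|i - j|\<close> with \<open>|r| < 1\<close>: by the Markov property, \<open>X t\<close> is orthogonal to the
  part of \<open>X u\<close> that is uncorrelated with \<open>X s\<close>, for \<open>u < s < t\<close>. So
  \<open>X k = r X (k - 1) + Z k\<close> with innovations of variance \<open>s\<^sup>2 (1 - r\<^sup>2)\<close>, the block density is a
  product of normal densities, and the entropy is \<open>(ln (2 \<pi> s\<^sup>2 (1 - r\<^sup>2)) + 1) / 2\<close>. At fixed \<open>s\<close>
  it determines exactly \<open>r\<^sup>2\<close>, and \<open>r\<close> and \<open>- r\<close> are exchanged by \<open>(- 1)^n\<close>. Equality of laws is
  always checked through \<open>E (cos (c + \<Sum> a j X j))\<close>.\<close>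

subsection \<open>Uniqueness of laws by trigonometric moments\<close>

text \<open>A characteristic function is complex, but the expectations of
  \<open>cos (c + ...)\<close> over all phases \<open>c\<close> carry both its real and its
  imaginary part, so the argument stays real. The resulting criterion compares three kinds of laws:
  two processes with equal covariances, a block of the process with its candidate density, and a
  Gaussian pair before and after a change of sign.

  The Markov hypothesis speaks of conditional expectations of indicators given the whole past, while
  the covariance needs a statement about \<open>X t\<close> itself. The bridge is a test variable in
  the past whose conditional expectation given \<open>X s\<close> vanishes; for a Gaussian process,
  lack of correlation provides one.

  No integral of rho ln rho over R^n is evaluated directly: it is the expectation of the log-density
  along the process, where only second moments of the innovations appear. The initial coordinate has
  variance s^2 instead of s^2 (1 - r^2), a discrepancy that disappears in the limit. Conversely, a
  law determines its correlation through E (X 1 X 0).\<close>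

lemma weighted_distr:
  fixes u :: "'a \<Rightarrow> real"
  assumes "prob_space M" and [measurable]: "u \<in> borel_measurable M" "w \<in> borel_measurable M"
    and w: "\<And>x. 0 \<le> w x" "\<And>x. w x \<le> (1::real)" and pos: "(\<integral>x. w x \<partial>M) > 0"
  defines "\<mu> \<equiv> distr (density M (\<lambda>x. ennreal (w x / (\<integral>x. w x \<partial>M)))) borel u"
  shows "real_distribution \<mu>"
    and "char \<mu> t = Complex ((\<integral>x. w x * cos (t * u x) \<partial>M) / (\<integral>x. w x \<partial>M))
           ((\<integral>x. w x * sin (t * u x) \<partial>M) / (\<integral>x. w x \<partial>M))"
    and "A \<in> sets borel \<Longrightarrow>
      measure \<mu> A = (\<integral>x. w x * indicator A (u x) \<partial>M) / (\<integral>x. w x \<partial>M)"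
proof -
  interpret prob_space M by fact
  define k where "k = (\<integral>x. w x \<partial>M)"
  have iw: "integrable M w" using w by (intro integrable_const_bound[of _ 1]) auto
  have "emeasure (density M (\<lambda>x. ennreal (w x / k))) (space M) = ennreal (\<integral>x. w x / k \<partial>M)"
  proof -
    have "emeasure (density M (\<lambda>x. ennreal (w x / k))) (space M) = (\<integral>\<^sup>+ x. ennreal (w x / k) \<partial>M)"
      by (subst emeasure_density) (auto intro!: nn_integral_cong)
    also have "\<dots> = ennreal (\<integral>x. w x / k \<partial>M)"
      using iw w pos by (intro nn_integral_eq_integral) (auto simp: k_def)
    finally show ?thesis .
  qed
  also have "\<dots> = 1" using pos by (simp add: k_def)
  finally have "prob_space (density M (\<lambda>x. ennreal (w x / k)))"
    by (intro prob_spaceI) simp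
  then interpret D: prob_space "density M (\<lambda>x. ennreal (w x / k))" .
  have mu: "\<mu> = distr (density M (\<lambda>x. ennreal (w x / k))) borel u" by (simp add: \<mu>_def k_def)
  show rd: "real_distribution \<mu>"
    unfolding mu real_distribution_def real_distribution_axioms_def
    by (auto intro!: D.prob_space_distr)
  then interpret R: real_distribution \<mu> .
  have int: "(\<integral>x. f x \<partial>\<mu>) = (\<integral>x. w x * f (u x) \<partial>M) / k"
    if [measurable]: "f \<in> borel_measurable borel" for f :: "real \<Rightarrow> real"
    unfolding mu using w pos
    by (subst integral_distr) (auto simp: integral_density k_def)
  have ic: "integrable \<mu> (\<lambda>x. iexp (t * x))" for t
    using R.integrable_iexp[of "\<lambda>x. of_real (t * x)"] by simp
  have "Re (char \<mu> t) = (\<integral>x. cos (t * x) \<partial>\<mu>)"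
    unfolding char_def by (subst integral_Re[OF ic, symmetric]) (simp add: Re_exp)
  moreover have "Im (char \<mu> t) = (\<integral>x. sin (t * x) \<partial>\<mu>)"
    unfolding char_def by (subst integral_Im[OF ic, symmetric]) (simp add: Im_exp)
  ultimately show "char \<mu> t = Complex ((\<integral>x. w x * cos (t * u x) \<partial>M) / (\<integral>x. w x \<partial>M))
           ((\<integral>x. w x * sin (t * u x) \<partial>M) / (\<integral>x. w x \<partial>M))"
    by (simp add: complex_eq_iff int k_def)
  show "A \<in> sets borel \<Longrightarrow>
      measure \<mu> A = (\<integral>x. w x * indicator A (u x) \<partial>M) / (\<integral>x. w x \<partial>M)"
    using int[of "indicator A"] by (simp add: k_def R.emeasure_eq_measure)
qed

text \<open>The weights have equal total mass (take \<open>t = 0\<close>, \<open>c = 0\<close>). If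
  it is zero, both sides vanish. Otherwise the normalized weights give probability measures whose
  images under \<open>u\<close> and \<open>v\<close> have equal characteristic functions, and Levy's
  uniqueness theorem applies.\<close>

lemma weighted_cos_eq_imp_weighted_indicator_eq:
  fixes u :: "'a \<Rightarrow> real" and v :: "'b \<Rightarrow> real"
  assumes M: "prob_space M" and mu[measurable]: "u \<in> borel_measurable M" "w \<in> borel_measurable M"
    and w: "\<And>x. 0 \<le> w x" "\<And>x. w x \<le> (1::real)"
    and N: "prob_space N" and mv[measurable]: "v \<in> borel_measurable N" "z \<in> borel_measurable N"
    and z: "\<And>x. 0 \<le> z x" "\<And>x. z x \<le> (1::real)"
    and eq: "\<And>t c. (\<integral>x. w x * cos (c + t * u x) \<partial>M) = (\<integral>x. z x * cos (c + t * v x) \<partial>N)"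
    and A: "A \<in> sets borel"
  shows "(\<integral>x. w x * indicator A (u x) \<partial>M) = (\<integral>x. z x * indicator A (v x) \<partial>N)"
proof -
  interpret M: prob_space M by fact
  interpret N: prob_space N by fact
  note A[measurable]
  have iw: "integrable M w" using w by (intro M.integrable_const_bound[of _ 1]) auto
  have iz: "integrable N z" using z by (intro N.integrable_const_bound[of _ 1]) auto
  have k: "(\<integral>x. w x \<partial>M) = (\<integral>x. z x \<partial>N)" using eq[of 0 0] by simp
  show ?thesis
  proof (cases "(\<integral>x. w x \<partial>M) = 0")
    case True
    then have "AE x in M. w x = 0" "AE x in N. z x = 0"
      using integral_nonneg_eq_0_iff_AE[OF iw] integral_nonneg_eq_0_iff_AE[OF iz] w z k by auto
    then have "AE x in M. w x * indicator A (u x) = 0" "AE x in N. z x * indicator A (v x) = 0"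
      by auto
    then show ?thesis by (simp add: integral_eq_zero_AE)
  next
    case False
    moreover have "(\<integral>x. w x \<partial>M) \<ge> 0" by (simp add: w)
    ultimately have p: "(\<integral>x. w x \<partial>M) > 0" by simp
    then have q: "(\<integral>x. z x \<partial>N) > 0" using k by simp
    note P = weighted_distr[where M = M and u = u and w = w, OF M mu w p]
    note Q = weighted_distr[where M = N and u = v and w = z, OF N mv z q]
    have "(\<integral>x. w x * sin (t * u x) \<partial>M) = (\<integral>x. z x * sin (t * v x) \<partial>N)" for t
    proof -
      \<comment> \<open>The phase \<open>- pi / 2\<close> turns the cosine into a sine and so yields
        the imaginary part of the characteristic function.\<close>
      have "cos (- pi / 2 + y) = sin y" for y :: real using cos_sin_eq[of "pi / 2 - y"] cos_minus[of "y - pi / 2"] by simp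
      then show ?thesis using eq[of "- pi / 2" t] by (simp only:)
    qed
    then have "char (distr (density M (\<lambda>x. ennreal (w x / (\<integral>x. w x \<partial>M)))) borel u) =
        char (distr (density N (\<lambda>x. ennreal (z x / (\<integral>x. z x \<partial>N)))) borel v)"
      unfolding fun_eq_iff P(2) Q(2) using eq[of 0] k by simp
    then have "distr (density M (\<lambda>x. ennreal (w x / (\<integral>x. w x \<partial>M)))) borel u =
        distr (density N (\<lambda>x. ennreal (z x / (\<integral>x. z x \<partial>N)))) borel v"
      using P(1) Q(1) by (intro Levy_uniqueness)
    then show ?thesis using P(3)[OF A] Q(3)[OF A] k p by simp
  qed
qed

text \<open>The weight \<open>w\<close> carries the indicators of the coordinates already treated. Multiplying it
  by \<open>(1 + cos (c + S)) / 2\<close> keeps it in \<open>[0, 1]\<close>, so that the one-dimensional uniqueness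
  theorem applies to the next coordinate.\<close>

lemma cos_eq_imp_prod_indicator_eq:
  fixes U :: "'i \<Rightarrow> 'a \<Rightarrow> real" and V :: "'i \<Rightarrow> 'b \<Rightarrow> real"
  assumes M: "prob_space M" and N: "prob_space N" and "finite J"
    and "\<And>j. j \<in> J \<Longrightarrow> U j \<in> borel_measurable M" "\<And>j. j \<in> J \<Longrightarrow> V j \<in> borel_measurable N"
    and "\<And>j. j \<in> J \<Longrightarrow> A j \<in> sets borel"
    and "w \<in> borel_measurable M" "\<And>x. 0 \<le> w x" "\<And>x. w x \<le> (1::real)"
    and "z \<in> borel_measurable N" "\<And>x. 0 \<le> z x" "\<And>x. z x \<le> (1::real)"
    and "\<And>a c. (\<integral>x. w x * cos (c + (\<Sum>j\<in>J. a j * U j x)) \<partial>M) =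
      (\<integral>x. z x * cos (c + (\<Sum>j\<in>J. a j * V j x)) \<partial>N)"
  shows "(\<integral>x. w x * (\<Prod>j\<in>J. indicator (A j) (U j x)) \<partial>M) =
      (\<integral>x. z x * (\<Prod>j\<in>J. indicator (A j) (V j x)) \<partial>N)"
  using assms(3-)
proof (induction J arbitrary: w z rule: finite_induct)
  case empty
  show ?case using empty.prems(10)[of 0] by simp
next
  case (insert i J)
  interpret M: prob_space M by fact
  interpret N: prob_space N by fact
  note [measurable] = insert.prems(4,7)
  have mU[measurable]: "U i \<in> borel_measurable M" "\<And>j. j \<in> J \<Longrightarrow> U j \<in> borel_measurable M"
    using insert.prems(1) by auto
  have mV[measurable]: "V i \<in> borel_measurable N" "\<And>j. j \<in> J \<Longrightarrow> V j \<in> borel_measurable N"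
    using insert.prems(2) by auto
  have [measurable]: "A i \<in> sets borel" using insert.prems(3) by auto
  note wz = insert.prems(5,6,8,9)
  have iw: "integrable M (\<lambda>x. w x * f x)" if "f \<in> borel_measurable M" "\<And>x. \<bar>f x\<bar> \<le> 1" for f
    using that wz by (intro M.integrable_const_bound[of _ 1]) (auto simp: abs_mult intro!: mult_le_one)
  have iz: "integrable N (\<lambda>x. z x * f x)" if "f \<in> borel_measurable N" "\<And>x. \<bar>f x\<bar> \<le> 1" for f
    using that wz by (intro N.integrable_const_bound[of _ 1]) (auto simp: abs_mult intro!: mult_le_one)
  have E: "(\<integral>x. w x * cos (c + (\<Sum>j\<in>J. a j * U j x) + t * U i x) \<partial>M) =
      (\<integral>x. z x * cos (c + (\<Sum>j\<in>J. a j * V j x) + t * V i x) \<partial>N)" for a c t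
  proof -
    have "(\<Sum>j\<in>J. (a(i := t)) j * f j) = (\<Sum>j\<in>J. a j * f j)" for f :: "'i \<Rightarrow> real"
      using insert.hyps by (intro sum.cong) auto
    then show ?thesis using insert.prems(10)[of c "a(i := t)"] insert.hyps
      by (simp add: algebra_simps)
  qed
  have E0: "(\<integral>x. w x * cos (c + t * U i x) \<partial>M) = (\<integral>x. z x * cos (c + t * V i x) \<partial>N)" for c t
    using E[of c "\<lambda>_. 0" t] by simp
  have cos2: "cos (c + s) * cos (d + t) = (cos (c + d + s + t) + cos (c - d + s + - t)) / 2" for c d s t :: real
    using cos_times_cos[of "c + s" "d + t"] by (simp add: algebra_simps)
  \<comment> \<open>The product of a cosine in the sum over \<open>J\<close> and a cosine in
    coordinate \<open>i\<close> becomes a sum of cosines of joint linear combinations, to which the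
    hypothesis on \<open>insert i J\<close> applies.\<close>
  have pw: "y * ((1 + cos (c + s)) / 2) * cos (d + t * u) =
      y * cos (d + t * u) / 2 + y * cos (c + d + s + t * u) / 4 + y * cos (c - d + s + - t * u) / 4"
    for y c s d t u :: real
  proof -
    have "y * ((1 + cos (c + s)) / 2) * cos (d + t * u) =
        y * cos (d + t * u) / 2 + y * (cos (c + s) * cos (d + t * u)) / 2" by (simp add: field_simps)
    then show ?thesis unfolding cos2 by (simp add: distrib_left add_divide_distrib)
  qed
  have bd: "0 \<le> (1 + cos y) / 2" "(1 + cos y) / 2 \<le> 1" for y :: real
    using cos_ge_minus_one[of y] cos_le_one[of y] by (auto simp del: cos_ge_minus_one)
  have bd': "\<bar>(1 + cos y) / 2 * indicator B u\<bar> \<le> 1" for y u :: real and B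
    using bd[of y] by (simp add: abs_mult indicator_def)
  have *: "(\<integral>x. (w x * ((1 + cos (c + (\<Sum>j\<in>J. a j * U j x))) / 2)) * indicator (A i) (U i x) \<partial>M) =
      (\<integral>x. (z x * ((1 + cos (c + (\<Sum>j\<in>J. a j * V j x))) / 2)) * indicator (A i) (V i x) \<partial>N)" for a c
  proof (rule weighted_cos_eq_imp_weighted_indicator_eq[OF M _ _ _ _ N])
    fix t d
    have "(\<integral>x. w x * ((1 + cos (c + (\<Sum>j\<in>J. a j * U j x))) / 2) * cos (d + t * U i x) \<partial>M) =
      (\<integral>x. w x * cos (d + t * U i x) / 2 + w x * cos (c + d + (\<Sum>j\<in>J. a j * U j x) + t * U i x) / 4
        + w x * cos (c - d + (\<Sum>j\<in>J. a j * U j x) + - t * U i x) / 4 \<partial>M)"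
      by (simp only: pw)
    also have "\<dots> = (\<integral>x. w x * cos (d + t * U i x) \<partial>M) / 2
        + (\<integral>x. w x * cos (c + d + (\<Sum>j\<in>J. a j * U j x) + t * U i x) \<partial>M) / 4
        + (\<integral>x. w x * cos (c - d + (\<Sum>j\<in>J. a j * U j x) + - t * U i x) \<partial>M) / 4"
      by (simp add: iw Bochner_Integration.integral_add)
    also have "\<dots> = (\<integral>x. z x * cos (d + t * V i x) \<partial>N) / 2
        + (\<integral>x. z x * cos (c + d + (\<Sum>j\<in>J. a j * V j x) + t * V i x) \<partial>N) / 4
        + (\<integral>x. z x * cos (c - d + (\<Sum>j\<in>J. a j * V j x) + - t * V i x) \<partial>N) / 4"
      by (simp only: E E0)
    also have "\<dots> = (\<integral>x. z x * cos (d + t * V i x) / 2 + z x * cos (c + d + (\<Sum>j\<in>J. a j * V j x) + t * V i x) / 4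
        + z x * cos (c - d + (\<Sum>j\<in>J. a j * V j x) + - t * V i x) / 4 \<partial>N)"
      by (simp add: iz Bochner_Integration.integral_add)
    also have "\<dots> = (\<integral>x. z x * ((1 + cos (c + (\<Sum>j\<in>J. a j * V j x))) / 2) * cos (d + t * V i x) \<partial>N)"
      by (simp only: pw)
    finally show "(\<integral>x. w x * ((1 + cos (c + (\<Sum>j\<in>J. a j * U j x))) / 2) * cos (d + t * U i x) \<partial>M) =
      (\<integral>x. z x * ((1 + cos (c + (\<Sum>j\<in>J. a j * V j x))) / 2) * cos (d + t * V i x) \<partial>N)" .
  next
    fix x
    show "0 \<le> w x * ((1 + cos (c + (\<Sum>j\<in>J. a j * U j x))) / 2)"
      by (rule mult_nonneg_nonneg[OF wz(1) bd(1)])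
    show "w x * ((1 + cos (c + (\<Sum>j\<in>J. a j * U j x))) / 2) \<le> 1"
      by (rule mult_le_one[OF wz(2) bd])
  next
    fix x
    show "0 \<le> z x * ((1 + cos (c + (\<Sum>j\<in>J. a j * V j x))) / 2)"
      by (rule mult_nonneg_nonneg[OF wz(3) bd(1)])
    show "z x * ((1 + cos (c + (\<Sum>j\<in>J. a j * V j x))) / 2) \<le> 1"
      by (rule mult_le_one[OF wz(4) bd])
  qed auto
  have **: "(\<integral>x. w x * indicator (A i) (U i x) \<partial>M) = (\<integral>x. z x * indicator (A i) (V i x) \<partial>N)"
    using E0 wz by (intro weighted_cos_eq_imp_weighted_indicator_eq[OF M _ _ _ _ N]) auto
  have iU1: "integrable M (\<lambda>x. w x * ((1 + cos (c + (\<Sum>j\<in>J. a j * U j x))) / 2) * indicator (A i) (U i x))" for a c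
    unfolding mult.assoc by (rule iw) (measurable, rule bd')
  have iU2: "integrable M (\<lambda>x. w x * indicator (A i) (U i x))"
    by (rule iw) (auto simp: indicator_def)
  have iV1: "integrable N (\<lambda>x. z x * ((1 + cos (c + (\<Sum>j\<in>J. a j * V j x))) / 2) * indicator (A i) (V i x))" for a c
    unfolding mult.assoc by (rule iz) (measurable, rule bd')
  have iV2: "integrable N (\<lambda>x. z x * indicator (A i) (V i x))"
    by (rule iz) (auto simp: indicator_def)
  have "(\<integral>x. (w x * indicator (A i) (U i x)) * (\<Prod>j\<in>J. indicator (A j) (U j x)) \<partial>M) =
      (\<integral>x. (z x * indicator (A i) (V i x)) * (\<Prod>j\<in>J. indicator (A j) (V j x)) \<partial>N)"
  proof (rule insert.IH)
    fix a c
    \<comment> \<open>The identity cos = 2 (1 + cos) / 2 - 1 undoes the passage to a nonnegative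
      weight: the cosine against the new weight \<open>w * indicator\<close> is a difference of two
      integrals already compared.\<close>
    have "(\<integral>x. w x * indicator (A i) (U i x) * cos (c + (\<Sum>j\<in>J. a j * U j x)) \<partial>M) =
      (\<integral>x. 2 * ((w x * ((1 + cos (c + (\<Sum>j\<in>J. a j * U j x))) / 2)) * indicator (A i) (U i x))
        - w x * indicator (A i) (U i x) \<partial>M)"
      by (intro Bochner_Integration.integral_cong refl) (simp add: algebra_simps add_divide_distrib)
    also have "\<dots> = 2 * (\<integral>x. (w x * ((1 + cos (c + (\<Sum>j\<in>J. a j * U j x))) / 2)) * indicator (A i) (U i x) \<partial>M)
        - (\<integral>x. w x * indicator (A i) (U i x) \<partial>M)"
      by (simp only: Bochner_Integration.integral_diff[OF integrable_mult_right[OF iU1] iU2]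
          integral_mult_right_zero)
    also have "\<dots> = 2 * (\<integral>x. (z x * ((1 + cos (c + (\<Sum>j\<in>J. a j * V j x))) / 2)) * indicator (A i) (V i x) \<partial>N)
        - (\<integral>x. z x * indicator (A i) (V i x) \<partial>N)" by (simp only: * **)
    also have "\<dots> = (\<integral>x. 2 * ((z x * ((1 + cos (c + (\<Sum>j\<in>J. a j * V j x))) / 2)) * indicator (A i) (V i x))
        - z x * indicator (A i) (V i x) \<partial>N)"
      by (simp only: Bochner_Integration.integral_diff[OF integrable_mult_right[OF iV1] iV2]
          integral_mult_right_zero)
    also have "\<dots> = (\<integral>x. z x * indicator (A i) (V i x) * cos (c + (\<Sum>j\<in>J. a j * V j x)) \<partial>N)"
      by (intro Bochner_Integration.integral_cong refl) (simp add: algebra_simps add_divide_distrib)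
    finally show "(\<integral>x. w x * indicator (A i) (U i x) * cos (c + (\<Sum>j\<in>J. a j * U j x)) \<partial>M) =
      (\<integral>x. z x * indicator (A i) (V i x) * cos (c + (\<Sum>j\<in>J. a j * V j x)) \<partial>N)" .
  qed (use wz insert.prems(3) in \<open>auto simp: indicator_def\<close>)
  then show ?case using insert.hyps by (simp add: mult.assoc)
qed

lemma emeasure_distr_prod_emb:
  fixes U :: "'i \<Rightarrow> 'a \<Rightarrow> real"
  assumes "prob_space M" and U: "\<And>j. j \<in> I \<Longrightarrow> U j \<in> borel_measurable M"
    and J: "finite J" "J \<subseteq> I" and A: "\<And>j. j \<in> J \<Longrightarrow> A j \<in> sets borel"
  shows "emeasure (distr M (Pi\<^sub>M I (\<lambda>_. borel)) (\<lambda>x. \<lambda>j\<in>I. U j x)) (prod_emb I (\<lambda>_. borel) J (Pi\<^sub>E J A)) =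
    ennreal (\<integral>x. (\<Prod>j\<in>J. indicator (A j) (U j x)) \<partial>M)"
proof -
  interpret prob_space M by fact
  let ?E = "prod_emb I (\<lambda>_. borel) J (Pi\<^sub>E J A)"
  have E[measurable]: "?E \<in> sets (Pi\<^sub>M I (\<lambda>_. borel))"
    using J A by (intro sets_PiM_I) auto
  have [measurable]: "(\<lambda>x. \<lambda>j\<in>I. U j x) \<in> measurable M (Pi\<^sub>M I (\<lambda>_. borel))"
    by (auto intro!: measurable_restrict U)
  have "emeasure (distr M (Pi\<^sub>M I (\<lambda>_. borel)) (\<lambda>x. \<lambda>j\<in>I. U j x)) ?E =
    ennreal (\<integral>x. indicator ((\<lambda>x. \<lambda>j\<in>I. U j x) -` ?E \<inter> space M) x \<partial>M)"
    by (subst emeasure_distr) (auto simp: emeasure_eq_measure)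
  also have "(\<integral>x. indicator ((\<lambda>x. \<lambda>j\<in>I. U j x) -` ?E \<inter> space M) x \<partial>M :: real) =
    (\<integral>x. (\<Prod>j\<in>J. indicator (A j) (U j x)) \<partial>M)"
  proof (intro Bochner_Integration.integral_cong refl)
    fix x assume "x \<in> space M"
    then have "x \<in> (\<lambda>x. \<lambda>j\<in>I. U j x) -` ?E \<inter> space M \<longleftrightarrow> (\<forall>j\<in>J. U j x \<in> A j)"
      using J by (auto simp: prod_emb_def PiE_iff restrict_def extensional_def subset_eq)
    then show "(indicator ((\<lambda>x. \<lambda>j\<in>I. U j x) -` ?E \<inter> space M) x :: real) =
        (\<Prod>j\<in>J. indicator (A j) (U j x))"
      using J by (auto simp: indicator_def)
  qed
  finally show ?thesis .
qed

text \<open>Cylinders over finite \<open>J\<close> determine a finite measure on the product space,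
  and on a cylinder the claim is the product of indicators with weight 1. The index type is
  arbitrary because the criterion is applied to whole processes, to finite blocks and to pairs
  indexed by \<open>bool\<close>.\<close>

lemma cos_eq_imp_distr_eq:
  fixes U :: "'i \<Rightarrow> 'a \<Rightarrow> real" and V :: "'i \<Rightarrow> 'b \<Rightarrow> real"
  assumes M: "prob_space M" and N: "prob_space N"
    and U: "\<And>j. j \<in> I \<Longrightarrow> U j \<in> borel_measurable M"
    and V: "\<And>j. j \<in> I \<Longrightarrow> V j \<in> borel_measurable N"
    and eq: "\<And>J a c. finite J \<Longrightarrow> J \<subseteq> I \<Longrightarrow>
      (\<integral>x. cos (c + (\<Sum>j\<in>J. a j * U j x)) \<partial>M) = (\<integral>x. cos (c + (\<Sum>j\<in>J. a j * V j x)) \<partial>N)"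
  shows "distr M (Pi\<^sub>M I (\<lambda>_. borel)) (\<lambda>x. \<lambda>j\<in>I. U j x) =
    distr N (Pi\<^sub>M I (\<lambda>_. borel)) (\<lambda>x. \<lambda>j\<in>I. V j x)"
proof (rule measure_eqI_PiM_infinite[where I = I and M = "\<lambda>_. borel"])
  interpret M: prob_space M by fact
  show "finite_measure (distr M (Pi\<^sub>M I (\<lambda>_. borel)) (\<lambda>x. \<lambda>j\<in>I. U j x))"
    by (intro M.finite_measure_distr measurable_restrict U)
  fix A :: "'i \<Rightarrow> real set" and J
  assume J: "finite J" "J \<subseteq> I" and A: "\<And>i. i \<in> J \<Longrightarrow> A i \<in> sets borel"
  have "(\<integral>x. (1::real) * (\<Prod>j\<in>J. indicator (A j) (U j x)) \<partial>M) =
      (\<integral>x. (1::real) * (\<Prod>j\<in>J. indicator (A j) (V j x)) \<partial>N)"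
    using J A eq[OF J] by (intro cos_eq_imp_prod_indicator_eq[OF M N]) (auto intro!: U V)
  then show "emeasure (distr M (Pi\<^sub>M I (\<lambda>_. borel)) (\<lambda>x. \<lambda>j\<in>I. U j x)) (prod_emb I (\<lambda>_. borel) J (Pi\<^sub>E J A)) =
      emeasure (distr N (Pi\<^sub>M I (\<lambda>_. borel)) (\<lambda>x. \<lambda>j\<in>I. V j x)) (prod_emb I (\<lambda>_. borel) J (Pi\<^sub>E J A))"
    by (simp add: emeasure_distr_prod_emb[OF M U J A] emeasure_distr_prod_emb[OF N V J A])
qed auto

subsection \<open>Centered Gaussian processes\<close>

text \<open>The substitution \<open>m + \<sigma> * x\<close> and the addition formula reduce this to
  the standard normal law. Its characteristic function is real, so the sine part vanishes.\<close>

lemma integral_cos_normal_density: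
  assumes "\<sigma> > 0"
  shows "(\<integral>x. normal_density m \<sigma> x * cos (c + a * x) \<partial>lborel) = cos (c + a * m) * exp (- (a\<^sup>2 * \<sigma>\<^sup>2 / 2))"
proof -
  let ?S = "density lborel (\<lambda>x. ennreal (std_normal_density x))"
  interpret R: real_distribution ?S by (rule real_dist_normal_dist)
  have ic: "integrable ?S (\<lambda>x. iexp (t * x))" for t
    using R.integrable_iexp[of "\<lambda>x. of_real (t * x)"] by simp
  have S: "(\<integral>x. f x \<partial>?S) = (\<integral>x. std_normal_density x * f x \<partial>lborel)"
    if "f \<in> borel_measurable borel" for f :: "real \<Rightarrow> real"
    using that by (subst integral_density) auto
  have i: "integrable lborel (\<lambda>x. std_normal_density x * f x)"
    if [measurable]: "f \<in> borel_measurable borel" and "\<And>x. \<bar>f x\<bar> \<le> 1" for f :: "real \<Rightarrow> real"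
    using that(2)
    by (intro Bochner_Integration.integrable_bound[OF integrable_normal_density[of 1 0]])
      (auto simp: abs_mult intro!: mult_left_le)
  have C: "(\<integral>x. std_normal_density x * cos (t * x) \<partial>lborel) = exp (- (t\<^sup>2 / 2))" for t
  proof -
    have "(\<integral>x. cos (t * x) \<partial>?S) = Re (char ?S t)"
      unfolding char_def by (subst integral_Re[OF ic, symmetric]) (simp add: Re_exp)
    then show ?thesis by (simp add: S char_std_normal_distribution)
  qed
  have D: "(\<integral>x. std_normal_density x * sin (t * x) \<partial>lborel) = 0" for t
  proof -
    have "(\<integral>x. sin (t * x) \<partial>?S) = Im (char ?S t)"
      unfolding char_def by (subst integral_Im[OF ic, symmetric]) (simp add: Im_exp)
    then show ?thesis by (simp add: S char_std_normal_distribution)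
  qed
  have "(\<integral>x. normal_density m \<sigma> x * cos (c + a * x) \<partial>lborel) =
      \<sigma> * (\<integral>x. normal_density m \<sigma> (m + \<sigma> * x) * cos (c + a * (m + \<sigma> * x)) \<partial>lborel)"
    using assms by (subst lborel_integral_real_affine[where t = m and c = \<sigma>]) auto
  also have "\<dots> = (\<integral>x. \<sigma> * (normal_density m \<sigma> (m + \<sigma> * x) * cos (c + a * (m + \<sigma> * x))) \<partial>lborel)"
    by simp
  also have "\<dots> = (\<integral>x. cos (c + a * m) * (std_normal_density x * cos (a * \<sigma> * x))
      - sin (c + a * m) * (std_normal_density x * sin (a * \<sigma> * x)) \<partial>lborel)"
  proof (intro Bochner_Integration.integral_cong refl)
    fix x
    have d: "\<sigma> * normal_density m \<sigma> (m + \<sigma> * x) = std_normal_density x"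
      using assms by (simp add: normal_density_def real_sqrt_mult power_mult_distrib)
    have e: "cos (c + a * (m + \<sigma> * x)) =
        cos (c + a * m) * cos (a * \<sigma> * x) - sin (c + a * m) * sin (a * \<sigma> * x)"
      unfolding cos_add[symmetric] by (simp add: algebra_simps)
    show "\<sigma> * (normal_density m \<sigma> (m + \<sigma> * x) * cos (c + a * (m + \<sigma> * x))) =
      cos (c + a * m) * (std_normal_density x * cos (a * \<sigma> * x))
      - sin (c + a * m) * (std_normal_density x * sin (a * \<sigma> * x))"
      unfolding mult.assoc[symmetric] d e by (simp add: algebra_simps)
  qed
  also have "\<dots> = cos (c + a * m) * exp (- ((a * \<sigma>)\<^sup>2 / 2))"
    using i[of "\<lambda>x. cos (a * \<sigma> * x)"] i[of "\<lambda>x. sin (a * \<sigma> * x)"]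
    by (subst Bochner_Integration.integral_diff) (auto simp: C D)
  finally show ?thesis by (simp add: power_mult_distrib)
qed

text \<open>Mean zero forces \<open>m = 0\<close> both for a point mass and for a normal density.
  The formula in terms of the second moment covers both cases at once, the point mass being the case
  of second moment 0.\<close>

lemma centered_gaussian_law_cos:
  assumes [measurable]: "u \<in> borel_measurable M" and G: "gaussian_law (distr M borel u)"
    and "(\<integral>x. u x \<partial>M) = 0"
  shows "integrable M (\<lambda>x. (u x)\<^sup>2)"
    and "(\<integral>x. cos (c + u x) \<partial>M) = cos c * exp (- ((\<integral>x. (u x)\<^sup>2 \<partial>M) / 2))"
proof -
  let ?\<mu> = "distr M borel u"
  have z: "(\<integral>x. x \<partial>?\<mu>) = 0" using assms(3) by (subst integral_distr) auto
  have *: "integrable ?\<mu> (\<lambda>x. x\<^sup>2) \<and> (\<integral>x. cos (c + x) \<partial>?\<mu>) = cos c * exp (- ((\<integral>x. x\<^sup>2 \<partial>?\<mu>) / 2))"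
    using G unfolding gaussian_law_def
  proof (elim disjE exE conjE)
    fix m assume mu: "?\<mu> = return borel m"
    have "m = 0" using z unfolding mu by (subst (asm) integral_return) auto
    moreover have "integrable (return borel 0) (\<lambda>x::real. x\<^sup>2)"
      by (simp add: integrable_iff_bounded nn_integral_return)
    ultimately show ?thesis unfolding mu by (simp add: integral_return)
  next
    fix m \<sigma> assume s: "\<sigma> > (0::real)" and mu: "?\<mu> = density lborel (\<lambda>x. ennreal (normal_density m \<sigma> x))"
    have I: "(\<integral>x. f x \<partial>?\<mu>) = (\<integral>x. normal_density m \<sigma> x * f x \<partial>lborel)"
      if "f \<in> borel_measurable borel" for f :: "real \<Rightarrow> real"
      unfolding mu using that by (subst integral_density) auto
    have m: "m = 0" using z integral_normal_moment_nz_1[OF s, of m] by (simp add: I)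
    have "integrable ?\<mu> (\<lambda>x. x\<^sup>2)" unfolding mu
      using integrable_normal_moment[OF s, of m 2] m by (subst integrable_density) auto
    moreover have "(\<integral>x. x\<^sup>2 \<partial>?\<mu>) = \<sigma>\<^sup>2"
      using integral_normal_moment_even[OF s, of m 1] m by (simp add: I)
    moreover have "(\<integral>x. cos (c + x) \<partial>?\<mu>) = cos c * exp (- (\<sigma>\<^sup>2 / 2))"
      using integral_cos_normal_density[OF s, of m c 1] m by (simp add: I)
    ultimately show ?thesis by simp
  qed
  then show "integrable M (\<lambda>x. (u x)\<^sup>2)"
    by (subst (asm) integrable_distr_eq) auto
  show "(\<integral>x. cos (c + u x) \<partial>M) = cos c * exp (- ((\<integral>x. (u x)\<^sup>2 \<partial>M) / 2))"
    using * by (simp add: integral_distr)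
qed

text \<open>Gaussianity is kept only in this form, which is what the uniqueness criterion consumes.
  The absence of a \<open>sin c\<close> term expresses the symmetry of every linear combination, and
  degenerate combinations are included.\<close>

locale centered_gaussian = prob_space M for M :: "'a measure" +
  fixes X :: "int \<Rightarrow> 'a \<Rightarrow> real"
  assumes measurable_X[measurable]: "X n \<in> borel_measurable M"
    and integrable_square: "integrable M (\<lambda>x. (X n x)\<^sup>2)"
    and cos_linear_combination: "finite J \<Longrightarrow> (\<integral>x. cos (c + (\<Sum>j\<in>J. a j * X j x)) \<partial>M) =
      cos c * exp (- ((\<integral>x. (\<Sum>j\<in>J. a j * X j x)\<^sup>2 \<partial>M) / 2))"
begin

definition cov :: "int \<Rightarrow> int \<Rightarrow> real" where
  "cov i j = (\<integral>x. X i x * X j x \<partial>M)"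

lemma integrable_mult_X[intro, simp]: "integrable M (\<lambda>x. X i x * X j x)"
proof (rule Bochner_Integration.integrable_bound)
  show "integrable M (\<lambda>x. (X i x)\<^sup>2 + (X j x)\<^sup>2)" by (intro Bochner_Integration.integrable_add integrable_square)
  have "\<bar>a * b\<bar> \<le> a\<^sup>2 + b\<^sup>2" for a b :: real
    using sum_squares_bound[of "\<bar>a\<bar>" "\<bar>b\<bar>"] abs_ge_zero[of "a * b"] 
    unfolding abs_mult power2_abs by linarith
  then show "AE x in M. norm (X i x * X j x) \<le> norm ((X i x)\<^sup>2 + (X j x)\<^sup>2)" by auto
qed simp

lemma second_moment_linear_combination:
  "(\<integral>x. (\<Sum>j\<in>J. a j * X j x)\<^sup>2 \<partial>M) = (\<Sum>i\<in>J. \<Sum>j\<in>J. a i * a j * cov i j)"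
proof -
  have "(\<integral>x. (\<Sum>j\<in>J. a j * X j x)\<^sup>2 \<partial>M) = (\<integral>x. (\<Sum>i\<in>J. \<Sum>j\<in>J. a i * a j * (X i x * X j x)) \<partial>M)"
    by (simp add: power2_eq_square sum_product ac_simps)
  also have "\<dots> = (\<Sum>i\<in>J. \<Sum>j\<in>J. a i * a j * cov i j)"
    by (subst Bochner_Integration.integral_sum | simp add: cov_def)+
  finally show ?thesis .
qed

lemma cov_commute: "cov i j = cov j i"
  by (simp add: cov_def mult.commute)

text \<open>The factors are absorbed into the coefficients of the linear combinations. Alternating
  signs give the process (-1)^n X n.\<close>

lemma scale:
  "centered_gaussian M (\<lambda>n x. e n * X n x)"
proof
  fix n show "integrable M (\<lambda>x. (e n * X n x)\<^sup>2)"
    by (simp add: power_mult_distrib integrable_square)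
next
  fix J :: "int set" and c a assume "finite J"
  then show "(\<integral>x. cos (c + (\<Sum>j\<in>J. a j * (e j * X j x))) \<partial>M) =
      cos c * exp (- ((\<integral>x. (\<Sum>j\<in>J. a j * (e j * X j x))\<^sup>2 \<partial>M) / 2))"
    using cos_linear_combination[of J c "\<lambda>j. a j * e j"] by (simp add: mult.assoc)
qed simp

end

text \<open>The expectations in the uniqueness criterion depend only on second moments of linear
  combinations, hence only on the covariances.\<close>

lemma centered_gaussian_law_eqI:
  assumes "centered_gaussian M X" "centered_gaussian N Y"
    and cov: "\<And>i j. centered_gaussian.cov M X i j = centered_gaussian.cov N Y i j"
  shows "process_law M X = process_law N Y"
proof -
  interpret X: centered_gaussian M X by fact
  interpret Y: centered_gaussian N Y by fact
  have "distr M (Pi\<^sub>M UNIV (\<lambda>_. borel)) (\<lambda>x. \<lambda>j\<in>UNIV. X j x) =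
      distr N (Pi\<^sub>M UNIV (\<lambda>_. borel)) (\<lambda>x. \<lambda>j\<in>UNIV. Y j x)"
    by (rule cos_eq_imp_distr_eq)
      (simp_all add: X.prob_space_axioms Y.prob_space_axioms X.cos_linear_combination
        Y.cos_linear_combination X.second_moment_linear_combination
        Y.second_moment_linear_combination cov)
  then show ?thesis by (simp add: process_law_def restrict_UNIV)
qed

lemma centered_gaussianI:
  assumes "real_process M X" "centered M X" "gaussian_process M X"
  shows "centered_gaussian M X"
proof -
  interpret prob_space M using assms(1) by (simp add: real_process_def)
  have [measurable]: "X n \<in> borel_measurable M" for n using assms(1) by (simp add: real_process_def)
  have int: "integrable M (X n)" "(\<integral>x. X n x \<partial>M) = 0" for n
    using assms(2) by (simp_all add: centered_def)
  have *: "gaussian_law (distr M borel (\<lambda>x. \<Sum>j\<in>J. a j * X j x))" if "finite J" for J a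
    using assms(3) that by (simp add: gaussian_process_def)
  have z: "(\<integral>x. (\<Sum>j\<in>J. a j * X j x) \<partial>M) = 0" for J a
    by (subst Bochner_Integration.integral_sum) (auto simp: int)
  show ?thesis
  proof
    fix n show "integrable M (\<lambda>x. (X n x)\<^sup>2)"
      using centered_gaussian_law_cos(1)[OF _ *[of "{n}" "\<lambda>_. 1"]] int by simp
    fix J :: "int set" and a c assume "finite J"
    then show "(\<integral>x. cos (c + (\<Sum>j\<in>J. a j * X j x)) \<partial>M) =
      cos c * exp (- ((\<integral>x. (\<Sum>j\<in>J. a j * X j x)\<^sup>2 \<partial>M) / 2))"
      by (intro centered_gaussian_law_cos(2) * z) auto
  qed simp
qed

subsection \<open>The Markov property\<close>

context prob_space
begin

lemma subalgebra_generated_algebra: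
  assumes "\<And>n. X n \<in> borel_measurable M"
  shows "subalgebra M (generated_algebra M X J)"
proof -
  have "(\<lambda>x. \<lambda>j\<in>J. X j x) \<in> measurable M (Pi\<^sub>M J (\<lambda>_. borel))"
    using assms by (intro measurable_restrict)
  then show ?thesis
    unfolding subalgebra_def generated_algebra_def
    by (auto dest: sets_image_in_sets[THEN subsetD, rotated])
qed

lemma measurable_generated_algebra:
  assumes "j \<in> J"
  shows "X j \<in> borel_measurable (generated_algebra M X J)"
proof -
  have "(\<lambda>x. \<lambda>j\<in>J. X j x) \<in> measurable (generated_algebra M X J) (Pi\<^sub>M J (\<lambda>_. borel))"
    unfolding generated_algebra_def by (intro measurable_vimage_algebra1) (auto simp: space_PiM)
  then have "(\<lambda>x. (\<lambda>j\<in>J. X j x) j) \<in> borel_measurable (generated_algebra M X J)"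
    by (rule measurable_compose[OF _ measurable_component_singleton[OF assms]])
  then show ?thesis using assms by simp
qed

lemma sets_generated_algebra_singleton:
  assumes "A \<in> sets (generated_algebra M X {s})"
  obtains B where "B \<in> sets borel" "A = X s -` B \<inter> space M"
proof -
  obtain C where C: "C \<in> sets (Pi\<^sub>M {s} (\<lambda>_. borel))" "A = (\<lambda>x. \<lambda>j\<in>{s}. X j x) -` C \<inter> space M"
    using assms unfolding generated_algebra_def
    by (subst (asm) sets_vimage_algebra2) (auto simp: space_PiM)
  have m: "(\<lambda>y. \<lambda>j\<in>{s}. y) \<in> measurable borel (Pi\<^sub>M {s} (\<lambda>_. borel :: real measure))"
    by measurable
  have "A = X s -` ((\<lambda>y. \<lambda>j\<in>{s}. y) -` C) \<inter> space M"
    unfolding C(2) by (auto simp: restrict_def cong: if_cong)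
  then show ?thesis
    using that measurable_sets[OF m C(1)] by simp
qed

lemma cond_exp_generated_algebra_singleton_eq_0:
  assumes X: "\<And>n. X n \<in> borel_measurable M" and V: "integrable M V"
    and 0: "\<And>B. B \<in> sets borel \<Longrightarrow> (\<integral>x. indicator B (X s x) * V x \<partial>M) = 0"
  shows "AE x in M. real_cond_exp M (generated_algebra M X {s}) V x = (0 :: real)"
proof -
  interpret S: finite_measure_subalgebra M "generated_algebra M X {s}"
    by unfold_locales (rule subalgebra_generated_algebra[OF X])
  show ?thesis
  proof (rule S.real_cond_exp_charact)
    fix A assume "A \<in> sets (generated_algebra M X {s})"
    then obtain B where B: "B \<in> sets borel" "A = X s -` B \<inter> space M"
      by (rule sets_generated_algebra_singleton)
    have "(\<integral>x\<in>A. V x \<partial>M) = (\<integral>x. indicator B (X s x) * V x \<partial>M)"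
      unfolding set_lebesgue_integral_def B(2)
      by (intro Bochner_Integration.integral_cong) (auto simp: indicator_def)
    then show "(\<integral>x\<in>A. V x \<partial>M) = (\<integral>x\<in>A. 0 \<partial>M)" using 0[OF B(1)] by simp
  qed (use V in auto)
qed

text \<open>The Markov property extends from indicators of \<open>X t\<close> to \<open>X t\<close> itself without any
  approximation: condition \<open>V\<close> on \<open>X t\<close>.\<close>

lemma markovian_imp_orthogonal:
  assumes X: "\<And>n. X n \<in> borel_measurable M" and "markovian M X" "s < t"
    and Vm: "V \<in> borel_measurable (generated_algebra M X {..s})"
    and V: "integrable M V" and tV: "integrable M (\<lambda>x. X t x * V x)"
    and 0: "\<And>B. B \<in> sets borel \<Longrightarrow> (\<integral>x. indicator B (X s x) * V x \<partial>M) = 0"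
  shows "(\<integral>x. X t x * V x \<partial>M) = 0"
proof -
  note X[measurable]
  interpret H: finite_measure_subalgebra M "generated_algebra M X {..s}"
    by unfold_locales (rule subalgebra_generated_algebra[OF X])
  interpret G: finite_measure_subalgebra M "generated_algebra M X {s}"
    by unfold_locales (rule subalgebra_generated_algebra[OF X])
  interpret T: finite_measure_subalgebra M "generated_algebra M X {t}"
    by unfold_locales (rule subalgebra_generated_algebra[OF X])
  have [measurable]: "V \<in> borel_measurable M" using V by simp
  have sV: "AE x in M. real_cond_exp M (generated_algebra M X {s}) V x = 0"
    by (intro cond_exp_generated_algebra_singleton_eq_0 X V 0)
  have "(\<integral>x. indicator B (X t x) * V x \<partial>M) = 0" if [measurable]: "B \<in> sets borel" for B
  proof -
    let ?b = "\<lambda>x. indicator B (X t x) :: real"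
    let ?H = "real_cond_exp M (generated_algebra M X {..s}) ?b"
    let ?G = "real_cond_exp M (generated_algebra M X {s}) ?b"
    have m: "AE x in M. ?H x = ?G x" using assms(2,3) that by (simp add: markovian_def)
    have i: "integrable M (\<lambda>x. V x * ?b x)"
      by (rule Bochner_Integration.integrable_bound[OF V]) (auto simp: indicator_def)
    note h = H.real_cond_exp_intg[OF i Vm]
    have h1: "integrable M (\<lambda>x. V x * ?H x)" by (rule h) simp
    \<comment> \<open>\<open>V\<close> belongs to the past, so the indicator may be replaced by its
      conditional expectation given the past, which the Markov property replaces by the one given
      \<open>X s\<close>.\<close>
    have "(\<integral>x. V x * ?b x \<partial>M) = (\<integral>x. V x * ?H x \<partial>M)" by (rule h(2)[symmetric]) simp
    also have "\<dots> = (\<integral>x. ?G x * V x \<partial>M)"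
      using m by (intro integral_cong_AE) auto
    \<comment> \<open>Now the roles change: \<open>?G\<close> depends on \<open>X s\<close> only, so
      \<open>V\<close> may be replaced by its conditional expectation given \<open>X s\<close>,
      which is zero.\<close>
    also have "\<dots> = (\<integral>x. ?G x * real_cond_exp M (generated_algebra M X {s}) V x \<partial>M)"
    proof (rule G.real_cond_exp_intg(2)[symmetric])
      show "integrable M (\<lambda>x. ?G x * V x)"
        by (rule integrable_cong_AE_imp[OF h1]) (use m in auto)
    qed auto
    also have "\<dots> = (\<integral>x. 0 \<partial>M)"
      using sV by (intro integral_cong_AE) auto
    finally show ?thesis by (simp add: mult.commute)
  qed
  \<comment> \<open>Orthogonality to all indicators of \<open>X t\<close> says that \<open>V\<close>
    has zero conditional expectation given \<open>X t\<close>; this gives orthogonality to the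
    unbounded variable \<open>X t\<close> as well.\<close>
  then have t0: "AE x in M. real_cond_exp M (generated_algebra M X {t}) V x = 0"
    by (intro cond_exp_generated_algebra_singleton_eq_0[OF X V])
  have "(\<integral>x. X t x * V x \<partial>M) = (\<integral>x. X t x * real_cond_exp M (generated_algebra M X {t}) V x \<partial>M)"
    by (rule T.real_cond_exp_intg(2)[symmetric, OF tV]) (auto intro: measurable_generated_algebra)
  also have "\<dots> = (\<integral>x. 0 \<partial>M)"
    using t0 by (intro integral_cong_AE) auto
  finally show ?thesis by simp
qed

end

context centered_gaussian
begin

lemma integrable_X[simp, intro]: "integrable M (X n)"
proof (rule Bochner_Integration.integrable_bound)
  show "integrable M (\<lambda>x. 1 + (X n x)\<^sup>2)" by (simp add: integrable_square)
  have "\<bar>a\<bar> \<le> 1 + a\<^sup>2" for a :: real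
    using sum_squares_bound[of 1 "\<bar>a\<bar>"] abs_ge_zero[of a] unfolding power2_abs by auto
  then show "AE x in M. norm (X n x) \<le> norm (1 + (X n x)\<^sup>2)"
    by auto
qed simp

text \<open>Since \<open>V\<close> and \<open>X s\<close> are uncorrelated, \<open>(V, X s)\<close> and \<open>(- V, X s)\<close> have the same law.\<close>

lemma uncorrelated_indicator:
  fixes u s :: int and k :: real
  defines "V \<equiv> \<lambda>x. X u x - k * X s x"
  assumes "u \<noteq> s" and 0: "cov u s = k * cov s s" and [measurable]: "B \<in> sets borel"
  shows "(\<integral>x. indicator B (X s x) * V x \<partial>M) = 0"
proof -
  have [measurable]: "V \<in> borel_measurable M" by (simp add: V_def)
  have XV: "X s x * V x = X s x * X u x - k * (X s x * X s x)"
    and VV: "(V x)\<^sup>2 = X u x * X u x - 2 * k * (X s x * X u x) + k\<^sup>2 * (X s x * X s x)" for x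
    by (simp_all add: V_def power2_eq_square algebra_simps)
  have int_XV: "integrable M (\<lambda>x. X s x * V x)" and int_VV: "integrable M (\<lambda>x. (V x)\<^sup>2)"
    unfolding XV VV
    by (intro Bochner_Integration.integrable_add Bochner_Integration.integrable_diff
        integrable_mult_right integrable_mult_X)+
  have "(\<integral>x. X s x * V x \<partial>M) = cov s u - k * cov s s"
    unfolding XV cov_def
    by (subst Bochner_Integration.integral_diff) (auto simp only: integral_mult_right_zero
        intro!: integrable_mult_right integrable_mult_X)
  then have XV0: "(\<integral>x. X s x * V x \<partial>M) = 0" using 0 by (simp add: cov_commute)
  \<comment> \<open>The cross term vanishes, so the value depends on \<open>p\<close> only through
    its square. This is the invariance under \<open>V\<close> to \<open>- V\<close>. In terms of the
    process, p V + q X s has coefficient \<open>p\<close> at \<open>u\<close> and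
    \<open>q - p * k\<close> at \<open>s\<close>.\<close>
  have cos2: "(\<integral>x. cos (c + (p * V x + q * X s x)) \<partial>M) =
      cos c * exp (- ((p\<^sup>2 * (\<integral>x. (V x)\<^sup>2 \<partial>M) + q\<^sup>2 * cov s s) / 2))" for c p q
  proof -
    let ?a = "\<lambda>j. if j = u then p else q - p * k"
    have a: "(\<Sum>j\<in>{u, s}. ?a j * X j x) = p * V x + q * X s x" for x
      using assms(2) by (simp add: V_def algebra_simps)
    have "(\<integral>x. (p * V x + q * X s x)\<^sup>2 \<partial>M) =
        (\<integral>x. p\<^sup>2 * (V x)\<^sup>2 + 2 * p * q * (X s x * V x) + q\<^sup>2 * (X s x)\<^sup>2 \<partial>M)"
      by (intro Bochner_Integration.integral_cong refl) (simp add: power2_eq_square algebra_simps)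
    also have "\<dots> = p\<^sup>2 * (\<integral>x. (V x)\<^sup>2 \<partial>M) + q\<^sup>2 * cov s s"
      using int_XV int_VV XV0 integrable_square[of s]
      by (simp add: cov_def power2_eq_square[of "X s _"])
    finally show ?thesis
      using cos_linear_combination[of "{u, s}" c ?a] unfolding a by simp
  qed
  \<comment> \<open>The pair is indexed by \<open>bool\<close>: \<open>True\<close> holds the signed
    residual and \<open>False\<close> holds \<open>X s\<close>.\<close>
  let ?U = "\<lambda>e b. if b then (\<lambda>x. e * V x) else X s"
  have "distr M (Pi\<^sub>M UNIV (\<lambda>_. borel)) (\<lambda>x. \<lambda>b\<in>UNIV. ?U 1 b x) =
      distr M (Pi\<^sub>M UNIV (\<lambda>_. borel)) (\<lambda>x. \<lambda>b\<in>UNIV. ?U (- 1) b x)"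
  proof (rule cos_eq_imp_distr_eq[OF prob_space_axioms prob_space_axioms])
    fix J :: "bool set" and a c
    have "(\<Sum>b\<in>J. a b * ?U e b x) = (if True \<in> J then a True * e else 0) * V x + (if False \<in> J then a False else 0) * X s x"
      for e x
    proof -
      have "(\<Sum>b\<in>J. a b * ?U e b x) = (\<Sum>b\<in>UNIV. if b \<in> J then a b * ?U e b x else 0)"
        by (simp add: sum.If_cases)
      then show ?thesis by (simp add: UNIV_bool)
    qed
    then show "(\<integral>x. cos (c + (\<Sum>b\<in>J. a b * ?U 1 b x)) \<partial>M) = (\<integral>x. cos (c + (\<Sum>b\<in>J. a b * ?U (- 1) b x)) \<partial>M)"
      by (simp only: cos2) auto
  qed auto
  then have "(\<integral>y. indicator B (y False) * y True \<partial>distr M (Pi\<^sub>M UNIV (\<lambda>_. borel)) (\<lambda>x. \<lambda>b\<in>UNIV. ?U 1 b x)) =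
      (\<integral>y. indicator B (y False) * y True \<partial>distr M (Pi\<^sub>M UNIV (\<lambda>_. borel)) (\<lambda>x. \<lambda>b\<in>UNIV. ?U (- 1) b x)) "
    by simp
  then have "(\<integral>x. indicator B (X s x) * V x \<partial>M) = (\<integral>x. indicator B (X s x) * (- V x) \<partial>M)"
    by (subst (asm) (1 2) integral_distr) (auto intro!: measurable_restrict)
  then show ?thesis by simp
qed

text \<open>\<open>k\<close> is the coefficient of the regression of \<open>X u\<close> on
  \<open>X s\<close>. The earlier variable \<open>X u\<close> is regressed, rather than
  \<open>X t\<close>, because the residual has to be measurable with respect to the past of
  \<open>s\<close>.\<close>

lemma markovian_cov:
  assumes "markovian M X" "u < s" "s < t" "cov s s \<noteq> 0"
  shows "cov t u = cov u s / cov s s * cov t s"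
proof -
  define k where "k = cov u s / cov s s"
  have "X j \<in> borel_measurable (generated_algebra M X {..s})" if "j \<le> s" for j
    using that by (intro measurable_generated_algebra) auto
  then have Vm: "(\<lambda>x. X u x - k * X s x) \<in> borel_measurable (generated_algebra M X {..s})"
    using assms by auto
  have e: "X t x * (X u x - k * X s x) = X t x * X u x - k * (X t x * X s x)" for x
    by (simp add: algebra_simps)
  have "(\<integral>x. X t x * (X u x - k * X s x) \<partial>M) = 0"
  proof (rule markovian_imp_orthogonal[OF measurable_X assms(1,3) Vm])
    fix B :: "real set" assume "B \<in> sets borel"
    then show "(\<integral>x. indicator B (X s x) * (X u x - k * X s x) \<partial>M) = 0"
      using assms by (intro uncorrelated_indicator) (auto simp: k_def)
  qed (auto simp: e)
  then have "cov t u - k * cov t s = 0" unfolding e cov_def by simp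
  then show ?thesis by (simp add: k_def)
qed

lemma stationary_cov:
  assumes "stationary M X"
  shows "cov (i + n) (j + n) = cov i j"
proof -
  have "process_law M (\<lambda>m. X (m + n)) = process_law M X"
    using assms by (simp add: stationary_def)
  moreover have "(\<integral>y. y i * y j \<partial>process_law M Z) = (\<integral>x. Z i x * Z j x \<partial>M)"
    if "\<And>n. Z n \<in> borel_measurable M" for Z
    unfolding process_law_def using that
    by (intro integral_distr measurable_PiM_single') auto
  from this[of X] this[of "\<lambda>m. X (m + n)"] show ?thesis
    using calculation by (simp add: cov_def)
qed

end

section \<open>Nondegeneracy from absolutely continuous marginals\<close>

lemma null_sets_linear_graph:
  fixes a :: "'i \<Rightarrow> real"
  assumes "finite J" "i \<notin> J"
  shows "{x \<in> space (Pi\<^sub>M (insert i J) (\<lambda>_. lborel)). x i = (\<Sum>j\<in>J. a j * x j)}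
    \<in> null_sets (Pi\<^sub>M (insert i J) (\<lambda>_. lborel))"
proof -
  interpret product_sigma_finite "\<lambda>_ :: 'i. lborel :: real measure"
    by unfold_locales
  let ?P = "Pi\<^sub>M (insert i J) (\<lambda>_. lborel :: real measure)"
  let ?S = "{x \<in> space ?P. x i = (\<Sum>j\<in>J. a j * x j)}"
  have S[measurable]: "?S \<in> sets ?P" by measurable
  have "emeasure ?P ?S = (\<integral>\<^sup>+ x. indicator ?S x \<partial>?P)" by simp
  also have "\<dots> = (\<integral>\<^sup>+ x. \<integral>\<^sup>+ y. indicator ?S (x(i := y)) \<partial>lborel \<partial>Pi\<^sub>M J (\<lambda>_. lborel))"
    using assms by (intro product_nn_integral_insert) auto
  also have "\<dots> = (\<integral>\<^sup>+ x. 0 \<partial>Pi\<^sub>M J (\<lambda>_. lborel :: real measure))"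
  proof (rule nn_integral_cong)
    fix x
    \<comment> \<open>Moving coordinate \<open>i\<close> leaves the sum over \<open>J\<close>
      unchanged, so each fibre of the graph has at most one point.\<close>
    have "(\<Sum>j\<in>J. a j * (x(i := y)) j) = (\<Sum>j\<in>J. a j * x j)" for y
      using assms by (intro sum.cong) auto
    then have "(\<integral>\<^sup>+ y. indicator ?S (x(i := y)) \<partial>lborel) \<le> (\<integral>\<^sup>+ y. indicator {\<Sum>j\<in>J. a j * x j} y \<partial>lborel)"
      by (intro nn_integral_mono) (auto simp: indicator_def)
    then show "(\<integral>\<^sup>+ y. indicator ?S (x(i := y)) \<partial>lborel) = 0" by simp
  qed
  finally show ?thesis using S by (auto intro: null_setsI)
qed

text \<open>A linear relation would put all mass of a marginal on a Lebesgue null hyperplane. The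
  case \<open>J = {}\<close> excludes variance zero, and \<open>J = {0}\<close> with
  \<open>i = 1\<close> excludes a correlation of modulus at least 1.\<close>

lemma (in prob_space) abs_continuous_marginals_not_linear:
  assumes X: "\<And>n. X n \<in> borel_measurable M" and "abs_continuous_marginals M X"
    and J: "finite J" "i \<notin> J"
  shows "\<not> (AE x in M. X i x = (\<Sum>j\<in>J. a j * X j x))"
proof
  note X[measurable]
  assume ae: "AE x in M. X i x = (\<Sum>j\<in>J. a j * X j x)"
  let ?I = "insert i J"
  let ?S = "{x \<in> space (Pi\<^sub>M ?I (\<lambda>_. lborel)). x i = (\<Sum>j\<in>J. a j * x j)}"
  have "?S \<in> null_sets (marginal_law M X ?I)"
    using assms null_sets_linear_graph[OF J, of a]
    unfolding abs_continuous_marginals_def absolutely_continuous_def by blast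
  then have "AE y in marginal_law M X ?I. y \<notin> ?S" by (rule AE_not_in)
  then have "AE x in M. (\<lambda>j\<in>?I. X j x) \<notin> ?S"
    unfolding marginal_law_def by (rule AE_distrD[rotated]) (auto intro!: measurable_restrict)
  then have "AE x in M. False"
    using ae
  proof eventually_elim
    case (elim x)
    have "(\<Sum>j\<in>J. a j * (\<lambda>j\<in>?I. X j x) j) = (\<Sum>j\<in>J. a j * X j x)"
      by (intro sum.cong) auto
    then show ?case using elim by (auto simp: space_PiM)
  qed
  then show False by simp
qed

text \<open>Stationarity, the Markov property and absolute continuity enter the entropy computation
  only through these three facts. Here \<open>s\<close> is the standard deviation and
  \<open>r\<close> the correlation of neighbours.\<close>

locale gauss_markov = centered_gaussian +
  fixes s r :: real
  assumes s_pos: "s > 0" and r_bound: "\<bar>r\<bar> < 1"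
    and cov_eq: "cov i j = s\<^sup>2 * r ^ nat \<bar>i - j\<bar>"

lemma gauss_markovI:
  assumes "real_process M X" "stationary M X" "centered M X" "gaussian_process M X"
    "markovian M X" "abs_continuous_marginals M X"
  obtains r where "gauss_markov M X (L2_norm M (X 0)) r"
proof -
  interpret centered_gaussian M X using assms by (intro centered_gaussianI)
  define c where "c = cov 0 0"
  define r where "r = cov 1 0 / c"
  have c: "cov n n = c" for n using stationary_cov[OF assms(2), of 0 n 0] by (simp add: c_def)
  have norm: "L2_norm M (X 0) = sqrt c" by (simp add: L2_norm_def c_def cov_def power2_eq_square)
  note abs = abs_continuous_marginals_not_linear[OF measurable_X assms(6)]
  have "c \<ge> 0" unfolding c_def cov_def by simp
  moreover have "c \<noteq> 0"
  proof
    assume "c = 0"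
    then have "AE x in M. (X 0 x)\<^sup>2 = 0"
      using integral_nonneg_eq_0_iff_AE[OF integrable_square[of 0]]
      by (simp add: c_def cov_def power2_eq_square)
    then show False using abs[of "{}" 0 "\<lambda>_. 0"] by simp
  qed
  ultimately have c_pos: "c > 0" by simp
  have c1: "cov (n + 1) n = c * r" for n
    using stationary_cov[OF assms(2), of 1 n 0] c_pos by (simp add: r_def add.commute)
  have ck: "cov (n + int k) n = c * r ^ k" for n k
  proof (induction k)
    case 0 then show ?case by (simp add: c)
  next
    case (Suc k)
    show ?case
    proof (cases "k = 0")
      case True then show ?thesis by (simp add: c1)
    next
      case False
      \<comment> \<open>The intermediate time is \<open>n + int k\<close>. It must lie strictly
        after \<open>n\<close>, which is why \<open>k = 0\<close> is treated apart.\<close>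
      have "cov (n + int k + 1) n = cov n (n + int k) / c * cov (n + int k + 1) (n + int k)"
        using markovian_cov[OF assms(5), of n "n + int k" "n + int k + 1"] False c_pos by (simp add: c)
      then show ?thesis using Suc c_pos c1[of "n + int k"] by (simp add: cov_commute[of n] ac_simps)
    qed
  qed
  have cov: "cov i j = c * r ^ nat \<bar>i - j\<bar>" for i j
  proof (cases "j \<le> i")
    case True then show ?thesis using ck[of j "nat (i - j)"] by simp
  next
    case False then show ?thesis using ck[of i "nat (j - i)"] by (simp add: cov_commute[of i])
  qed
  have "\<bar>r\<bar> < 1"
  proof (rule ccontr)
    assume "\<not> \<bar>r\<bar> < 1"
    then have "1 \<le> r\<^sup>2" using abs_square_less_1[of r] by linarith
    \<comment> \<open>The error of predicting \<open>X 1\<close> by \<open>r * X 0\<close> has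
      second moment c (1 - r^2). Were this not positive, \<open>X 1\<close> would almost surely be a
      multiple of \<open>X 0\<close>.\<close>
    let ?Z = "\<lambda>x. (X 1 x - r * X 0 x)\<^sup>2"
    have e: "?Z = (\<lambda>x. X 1 x * X 1 x - 2 * r * (X 1 x * X 0 x) + r\<^sup>2 * (X 0 x * X 0 x))"
      by (auto simp: power2_eq_square algebra_simps)
    have i: "integrable M ?Z" unfolding e by auto
    have "(\<integral>x. ?Z x \<partial>M) = cov 1 1 - 2 * r * cov 1 0 + r\<^sup>2 * cov 0 0"
      unfolding e cov_def by simp
    also have "\<dots> = c * (1 - r\<^sup>2)" by (simp add: cov power2_eq_square algebra_simps)
    also have "\<dots> \<le> 0" using \<open>1 \<le> r\<^sup>2\<close> c_pos by (simp add: mult_le_0_iff)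
    finally have "(\<integral>x. ?Z x \<partial>M) = 0" by (simp add: order_antisym)
    then have "AE x in M. ?Z x = 0" using integral_nonneg_eq_0_iff_AE[OF i] by simp
    then have "AE x in M. X 1 x = r * X 0 x" by auto
    then show False using abs[of "{0}" 1 "\<lambda>_. r"] by simp
  qed
  then have "gauss_markov M X (sqrt c) r"
    using c_pos by unfold_locales (auto simp: cov)
  then show ?thesis using that norm by simp
qed

subsection \<open>Block densities and entropy\<close>

text \<open>Blocks start at index 0. That coordinate has no predecessor in the block and is
  predicted by its mean 0, with the full standard deviation \<open>s\<close> as error.\<close>

definition prediction :: "real \<Rightarrow> (int \<Rightarrow> real) \<Rightarrow> int \<Rightarrow> real" where
  "prediction r x k = (if k = 0 then 0 else r * x (k - 1))"

definition innovation_sd :: "real \<Rightarrow> real \<Rightarrow> int \<Rightarrow> real" where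
  "innovation_sd s r k = (if k = 0 then s else s * sqrt (1 - r\<^sup>2))"

definition path_density :: "real \<Rightarrow> real \<Rightarrow> nat \<Rightarrow> (int \<Rightarrow> real) \<Rightarrow> real" where
  "path_density s r n x =
     (\<Prod>k\<in>{0..<int n}. normal_density (prediction r x k) (innovation_sd s r k) (x k))"

lemma atLeastLessThan_int_Suc: "{0..<int (Suc n)} = insert (int n) {0..<int n}"
  by auto

text \<open>The factors with index below \<open>n\<close> involve only coordinates below
  \<open>n\<close>, so the new coordinate occurs in a single factor. This makes induction by
  integrating out the last coordinate possible.\<close>

lemma path_density_Suc:
  "path_density s r (Suc n) (x(int n := y)) =
    path_density s r n x * normal_density (prediction r x (int n)) (innovation_sd s r (int n)) y"
proof -
  have "(\<Prod>k\<in>{0..<int n}. normal_density (prediction r (x(int n := y)) k) (innovation_sd s r k) ((x(int n := y)) k)) =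
      path_density s r n x"
    unfolding path_density_def by (intro prod.cong) (auto simp: prediction_def)
  moreover have "prediction r (x(int n := y)) (int n) = prediction r x (int n)"
    by (simp add: prediction_def)
  ultimately show ?thesis
    unfolding path_density_def[of s r "Suc n"] atLeastLessThan_int_Suc
    by (simp add: mult.commute)
qed

lemma measurable_prediction[measurable]:
  assumes "k \<in> {0..<int n}"
  shows "(\<lambda>x. prediction r x k) \<in> borel_measurable (Pi\<^sub>M {0..<int n} (\<lambda>_. lborel))"
proof (cases "k = 0")
  case False
  then have "k - 1 \<in> {0..<int n}" using assms by auto
  then have "(\<lambda>x. x (k - 1)) \<in> borel_measurable (Pi\<^sub>M {0..<int n} (\<lambda>_. lborel :: real measure))"
    by measurable
  then show ?thesis using False unfolding prediction_def by simp
qed (simp add: prediction_def)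

lemma measurable_path_density[measurable]:
  "path_density s r n \<in> borel_measurable (Pi\<^sub>M {0..<int n} (\<lambda>_. lborel))"
proof -
  have "(\<lambda>x. normal_density (prediction r x k) (innovation_sd s r k) (x k))
      \<in> borel_measurable (Pi\<^sub>M {0..<int n} (\<lambda>_. lborel))" if "k \<in> {0..<int n}" for k
  proof -
    have [measurable]: "(\<lambda>x. x k) \<in> borel_measurable (Pi\<^sub>M {0..<int n} (\<lambda>_. lborel :: real measure))"
      using that by measurable
    note measurable_prediction[OF that, measurable]
    show ?thesis unfolding normal_density_def by measurable
  qed
  then show ?thesis unfolding path_density_def by measurable
qed

lemma path_density_nonneg[simp]: "0 \<le> path_density s r n x"
  unfolding path_density_def by (intro prod_nonneg) auto

context gauss_markov
begin

abbreviation "sd \<equiv> innovation_sd s r"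
abbreviation "\<rho> \<equiv> path_density s r"
abbreviation "L n \<equiv> Pi\<^sub>M {0..<int n} (\<lambda>_. lborel :: real measure)"

section \<open>Innovations: orthogonality and variance\<close>

definition innovation :: "int \<Rightarrow> 'a \<Rightarrow> real" where
  "innovation k x = X k x - prediction r (\<lambda>j. X j x) k"

lemma r2: "r\<^sup>2 < 1"
  using r_bound abs_square_less_1 by blast

lemma sd_pos: "sd k > 0"
  using s_pos r2 by (simp add: innovation_sd_def)

lemma path_density_pos: "\<rho> n x > 0"
  unfolding path_density_def by (intro prod_pos normal_density_pos sd_pos)

lemma measurable_innovation[measurable]: "innovation k \<in> borel_measurable M"
  unfolding innovation_def[abs_def] prediction_def by simp

text \<open>For \<open>j < k\<close> the geometric covariance satisfies cov j k = r cov j (k - 1).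
  The bounds on \<open>j\<close> force \<open>k > 0\<close>, so that \<open>prediction\<close> is in
  its second case.\<close>

lemma innovation_orthogonal:
  assumes "0 \<le> j" "j < k"
  shows "integrable M (\<lambda>x. X j x * innovation k x)" "(\<integral>x. X j x * innovation k x \<partial>M) = 0"
proof -
  have e: "X j x * innovation k x = X j x * X k x - r * (X j x * X (k - 1) x)" for x
    using assms by (simp add: innovation_def prediction_def algebra_simps)
  show "integrable M (\<lambda>x. X j x * innovation k x)" unfolding e by auto
  have n: "nat \<bar>j - k\<bar> = Suc (nat \<bar>j - (k - 1)\<bar>)" using assms by auto
  have "(\<integral>x. X j x * innovation k x \<partial>M) = cov j k - r * cov j (k - 1)"
    unfolding e cov_def by simp
  then show "(\<integral>x. X j x * innovation k x \<partial>M) = 0" by (simp add: cov_eq n)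
qed

lemma innovation_square:
  assumes "0 \<le> k"
  shows "integrable M (\<lambda>x. (innovation k x)\<^sup>2)" "(\<integral>x. (innovation k x)\<^sup>2 \<partial>M) = (sd k)\<^sup>2"
proof -
  have "integrable M (\<lambda>x. (innovation k x)\<^sup>2) \<and> (\<integral>x. (innovation k x)\<^sup>2 \<partial>M) = (sd k)\<^sup>2"
  proof (cases "k = 0")
    case True
    then show ?thesis
      using cov_eq[of 0 0] integrable_square[of 0]
      by (simp add: innovation_def prediction_def innovation_sd_def cov_def power2_eq_square)
  next
    case False
    have e: "(innovation k x)\<^sup>2 = X k x * X k x - 2 * r * (X k x * X (k - 1) x) + r\<^sup>2 * (X (k - 1) x * X (k - 1) x)" for x
      using False by (simp add: innovation_def prediction_def power2_eq_square algebra_simps)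
    have "(\<integral>x. (innovation k x)\<^sup>2 \<partial>M) = cov k k - 2 * r * cov k (k - 1) + r\<^sup>2 * cov (k - 1) (k - 1)"
      unfolding e cov_def by simp
    also have "\<dots> = s\<^sup>2 * (1 - r\<^sup>2)" by (simp add: cov_eq power2_eq_square algebra_simps)
    also have "\<dots> = (sd k)\<^sup>2" using False r2 by (simp add: innovation_sd_def power_mult_distrib)
    finally have "(\<integral>x. (innovation k x)\<^sup>2 \<partial>M) = (sd k)\<^sup>2" .
    moreover have "integrable M (\<lambda>x. (innovation k x)\<^sup>2)" unfolding e by auto
    ultimately show ?thesis by simp
  qed
  then show "integrable M (\<lambda>x. (innovation k x)\<^sup>2)" "(\<integral>x. (innovation k x)\<^sup>2 \<partial>M) = (sd k)\<^sup>2" by auto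
qed

text \<open>The prediction of coordinate \<open>int n\<close> adds \<open>b * r\<close> to the
  coefficient of coordinate \<open>int n - 1\<close>. For \<open>n = 0\<close> that index lies
  outside the range, in agreement with the prediction being 0.\<close>

lemma prediction_linear:
  "(\<Sum>k\<in>{0..<int n}. a k * x k) + b * prediction r x (int n) =
    (\<Sum>k\<in>{0..<int n}. (a k + (if k = int n - 1 then b * r else 0)) * x k)"
proof -
  have "(\<Sum>k\<in>{0..<int n}. (if k = int n - 1 then b * r else 0) * x k) = b * prediction r x (int n)"
  proof -
    have "(\<Sum>k\<in>{0..<int n}. (if k = int n - 1 then b * r else 0) * x k) =
        (\<Sum>k\<in>{0..<int n}. if k = int n - 1 then b * r * x k else 0)"
      by (intro sum.cong) auto
    then show ?thesis by (auto simp: prediction_def)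
  qed
  then show ?thesis by (simp add: distrib_right sum.distrib)
qed

text \<open>Pythagoras: \<open>X n\<close> is its prediction plus an innovation orthogonal to all
  earlier coordinates of the block. The added term matches the exponent obtained by integrating out
  the last normal factor.\<close>

lemma second_moment_Suc:
  fixes a :: "int \<Rightarrow> real" and n :: nat
  defines "b \<equiv> a (int n)"
  shows "(\<integral>x. (\<Sum>k\<in>{0..<int (Suc n)}. a k * X k x)\<^sup>2 \<partial>M) =
    (\<integral>x. (\<Sum>k\<in>{0..<int n}. (a k + (if k = int n - 1 then b * r else 0)) * X k x)\<^sup>2 \<partial>M) + b\<^sup>2 * (sd (int n))\<^sup>2"
proof -
  let ?a = "\<lambda>k. a k + (if k = int n - 1 then b * r else 0)"
  let ?S = "\<lambda>x. \<Sum>k\<in>{0..<int n}. ?a k * X k x"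
  let ?Z = "innovation (int n)"
  have S: "(\<Sum>k\<in>{0..<int (Suc n)}. a k * X k x) = ?S x + b * ?Z x" for x
    unfolding prediction_linear[symmetric, where n = n and a = a and x = "\<lambda>j. X j x"] atLeastLessThan_int_Suc innovation_def
    by (simp add: b_def algebra_simps)
  have SS: "integrable M (\<lambda>x. (?S x)\<^sup>2)"
    unfolding power2_eq_square sum_product
    by (intro Bochner_Integration.integrable_sum) (simp add: mult.left_commute[of "X _ _"] mult.assoc integrable_mult_X)
  have e: "?S x * ?Z x = (\<Sum>k\<in>{0..<int n}. ?a k * (X k x * ?Z x))" for x
    by (simp add: sum_distrib_right mult.assoc)
  have SZ: "integrable M (\<lambda>x. ?S x * ?Z x)" "(\<integral>x. ?S x * ?Z x \<partial>M) = 0"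
    unfolding e using innovation_orthogonal
    by (auto intro!: Bochner_Integration.integrable_sum sum.neutral simp: Bochner_Integration.integral_sum)
  have "(\<integral>x. (?S x + b * ?Z x)\<^sup>2 \<partial>M) = (\<integral>x. (?S x)\<^sup>2 + 2 * b * (?S x * ?Z x) + b\<^sup>2 * (?Z x)\<^sup>2 \<partial>M)"
    by (intro Bochner_Integration.integral_cong refl) (simp add: power2_eq_square algebra_simps)
  also have "\<dots> = (\<integral>x. (?S x)\<^sup>2 \<partial>M) + b\<^sup>2 * (sd (int n))\<^sup>2"
  proof -
    have "(\<integral>x. (?S x)\<^sup>2 + 2 * b * (?S x * ?Z x) + b\<^sup>2 * (?Z x)\<^sup>2 \<partial>M) =
        (\<integral>x. (?S x)\<^sup>2 \<partial>M) + 2 * b * (\<integral>x. ?S x * ?Z x \<partial>M) + b\<^sup>2 * (\<integral>x. (?Z x)\<^sup>2 \<partial>M)"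
      using SS SZ(1) innovation_square(1)[of "int n"]
      by (simp only: Bochner_Integration.integral_add Bochner_Integration.integrable_add
          integrable_mult_right integral_mult_right_zero)
    then show ?thesis using SZ(2) innovation_square(2)[of "int n"] by simp
  qed
  finally show ?thesis unfolding S .
qed

sublocale L: product_sigma_finite "\<lambda>_ :: int. lborel :: real measure"
  by unfold_locales

section \<open>The density of a block\<close>

lemma nn_integral_path_density: "(\<integral>\<^sup>+ x. ennreal (\<rho> n x) \<partial>L n) = 1"
proof (induction n)
  case 0
  then show ?case by (simp add: path_density_def PiM_empty)
next
  case (Suc n)
  have "(\<integral>\<^sup>+ x. ennreal (\<rho> (Suc n) x) \<partial>L (Suc n)) =
      (\<integral>\<^sup>+ x. \<integral>\<^sup>+ y. ennreal (\<rho> (Suc n) (x(int n := y))) \<partial>lborel \<partial>L n)"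
    unfolding atLeastLessThan_int_Suc
    by (rule L.product_nn_integral_insert)
      (use measurable_path_density[of s r "Suc n", unfolded atLeastLessThan_int_Suc] in auto)
  also have "\<dots> = (\<integral>\<^sup>+ x. ennreal (\<rho> n x) \<partial>L n)"
  proof (rule nn_integral_cong)
    fix x
    have "(\<integral>\<^sup>+ y. ennreal (normal_density (prediction r x (int n)) (sd (int n)) y) \<partial>lborel) = 1"
      using sd_pos by (subst nn_integral_eq_integral) auto
    then show "(\<integral>\<^sup>+ y. ennreal (\<rho> (Suc n) (x(int n := y))) \<partial>lborel) = ennreal (\<rho> n x)"
      by (simp add: path_density_Suc ennreal_mult nn_integral_cmult)
  qed
  finally show ?case using Suc by simp
qed

lemma integrable_path_density: "integrable (L n) (\<rho> n)"
  by (rule integrableI_nonneg) (auto simp: nn_integral_path_density)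

lemma integrable_path_density_cos:
  "integrable (L n) (\<lambda>x. \<rho> n x * cos (c + (\<Sum>k\<in>{0..<int n}. a k * x k)))"
proof (rule Bochner_Integration.integrable_bound[OF integrable_path_density])
  have [measurable]: "(\<lambda>x. x k) \<in> borel_measurable (L n)" if "k \<in> {0..<int n}" for k
    using that by measurable
  show "(\<lambda>x. \<rho> n x * cos (c + (\<Sum>k\<in>{0..<int n}. a k * x k))) \<in> borel_measurable (L n)"
    by measurable
qed (auto simp: abs_mult intro!: mult_left_le)

text \<open>Both sides satisfy the same recursion in \<open>n\<close>: dropping the last coordinate moves its
  coefficient, times \<open>r\<close>, to the coordinate before and contributes the factor of the innovation.\<close>

lemma integral_path_density_cos:
  "(\<integral>x. \<rho> n x * cos (c + (\<Sum>k\<in>{0..<int n}. a k * x k)) \<partial>L n) =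
    (\<integral>x. cos (c + (\<Sum>k\<in>{0..<int n}. a k * X k x)) \<partial>M)"
proof (induction n arbitrary: a)
  case 0
  have "(\<integral>x. \<rho> 0 x \<partial>L 0) = 1"
    by (simp add: path_density_def PiM_empty lebesgue_integral_count_space_finite)
  then show ?case by (simp add: prob_space)
next
  case (Suc n)
  define b where "b = a (int n)"
  let ?a = "\<lambda>k. a k + (if k = int n - 1 then b * r else 0)"
  have "(\<integral>x. \<rho> (Suc n) x * cos (c + (\<Sum>k\<in>{0..<int (Suc n)}. a k * x k)) \<partial>L (Suc n)) =
      (\<integral>x. \<integral>y. \<rho> (Suc n) (x(int n := y)) * cos (c + (\<Sum>k\<in>{0..<int (Suc n)}. a k * (x(int n := y)) k)) \<partial>lborel \<partial>L n)"
    using integrable_path_density_cos[of "Suc n" c a] unfolding atLeastLessThan_int_Suc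
    by (intro L.product_integral_insert) auto
  also have "\<dots> = (\<integral>x. (\<rho> n x * cos (c + (\<Sum>k\<in>{0..<int n}. ?a k * x k))) * exp (- (b\<^sup>2 * (sd (int n))\<^sup>2 / 2)) \<partial>L n)"
  proof (rule Bochner_Integration.integral_cong[OF refl])
    fix x
    have e: "(\<Sum>k\<in>{0..<int (Suc n)}. a k * (x(int n := y)) k) = (\<Sum>k\<in>{0..<int n}. a k * x k) + b * y" for y
    proof -
      have "(\<Sum>k\<in>{0..<int n}. a k * (x(int n := y)) k) = (\<Sum>k\<in>{0..<int n}. a k * x k)"
        by (intro sum.cong) auto
      then show ?thesis unfolding atLeastLessThan_int_Suc by (simp add: b_def)
    qed
    have "(\<integral>y. \<rho> (Suc n) (x(int n := y)) * cos (c + (\<Sum>k\<in>{0..<int (Suc n)}. a k * (x(int n := y)) k)) \<partial>lborel) =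
       (\<integral>y. \<rho> n x * (normal_density (prediction r x (int n)) (sd (int n)) y * cos ((c + (\<Sum>k\<in>{0..<int n}. a k * x k)) + b * y)) \<partial>lborel)"
      unfolding e path_density_Suc by (simp add: mult.assoc add.assoc)
    also have "\<dots> = \<rho> n x * (cos ((c + (\<Sum>k\<in>{0..<int n}. a k * x k)) + b * prediction r x (int n)) * exp (- (b\<^sup>2 * (sd (int n))\<^sup>2 / 2)))"
      by (simp only: integral_mult_right_zero integral_cos_normal_density[OF sd_pos])
    also have "\<dots> = (\<rho> n x * cos (c + (\<Sum>k\<in>{0..<int n}. ?a k * x k))) * exp (- (b\<^sup>2 * (sd (int n))\<^sup>2 / 2))"
      by (simp only: add.assoc prediction_linear mult.assoc)
    finally show "(\<integral>y. \<rho> (Suc n) (x(int n := y)) * cos (c + (\<Sum>k\<in>{0..<int (Suc n)}. a k * (x(int n := y)) k)) \<partial>lborel) = \<dots>" .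
  qed
  also have "\<dots> = (\<integral>x. cos (c + (\<Sum>k\<in>{0..<int n}. ?a k * X k x)) \<partial>M) * exp (- (b\<^sup>2 * (sd (int n))\<^sup>2 / 2))"
    using Suc.IH[of ?a] by (simp only: integral_mult_left_zero)
  also have "\<dots> = (\<integral>x. cos (c + (\<Sum>k\<in>{0..<int (Suc n)}. a k * X k x)) \<partial>M)"
    unfolding cos_linear_combination[OF finite_atLeastLessThan_int] second_moment_Suc b_def[symmetric]
    by (simp add: exp_add[symmetric] add_divide_distrib)
  finally show ?case .
qed

lemma marginal_law_eq_density:
  "marginal_law M X {0..<int n} = density (L n) (\<lambda>x. ennreal (\<rho> n x))" (is "_ = ?D")
proof -
  let ?I = "{0..<int n}"
  have D: "prob_space ?D"
    by (intro prob_spaceI) (simp add: emeasure_density nn_integral_path_density cong: nn_integral_cong_simp)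
  have sets: "sets ?D = sets (Pi\<^sub>M ?I (\<lambda>_. borel))"
    by (simp cong: sets_PiM_cong)
  have comp: "(\<lambda>x. x j) \<in> borel_measurable (L n)" if "j \<in> ?I" for j using that by measurable
  have "distr M (Pi\<^sub>M ?I (\<lambda>_. borel)) (\<lambda>x. \<lambda>j\<in>?I. X j x) =
      distr ?D (Pi\<^sub>M ?I (\<lambda>_. borel)) (\<lambda>x. \<lambda>j\<in>?I. x j)"
  proof (rule cos_eq_imp_distr_eq[OF prob_space_axioms D])
    fix J a c assume J: "finite J" "J \<subseteq> ?I"
    \<comment> \<open>A combination over part of the block is padded with zero coefficients, since
      the cosine formula is stated for full blocks.\<close>
    have e: "(\<Sum>j\<in>J. a j * f j) = (\<Sum>j\<in>?I. (if j \<in> J then a j else 0) * f j)" for f :: "int \<Rightarrow> real"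
      using J by (intro sum.mono_neutral_cong_left) auto
    have m: "(\<lambda>x. cos (c + (\<Sum>j\<in>?I. (if j \<in> J then a j else 0) * x j))) \<in> borel_measurable (L n)"
      using comp by measurable
    show "(\<integral>x. cos (c + (\<Sum>j\<in>J. a j * X j x)) \<partial>M) = (\<integral>x. cos (c + (\<Sum>j\<in>J. a j * x j)) \<partial>?D)"
      unfolding e integral_path_density_cos[symmetric] using m
      by (subst integral_density) auto
  qed (use comp in auto)
  \<comment> \<open>Points of the product space are extensional, so restricting them to the block
    changes nothing.\<close>
  also have "\<dots> = distr ?D ?D (\<lambda>x. x)"
    using sets by (intro distr_cong) (auto simp: space_PiM PiE_iff extensional_def restrict_def fun_eq_iff)
  finally show ?thesis by (simp add: marginal_law_def distr_id)
qed

section \<open>Log-density, block entropy and entropy rate\<close>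

lemma AE_block_density: "AE x in L n. block_density M X n x = \<rho> n x"
proof -
  interpret F: finite_product_sigma_finite "\<lambda>_. lborel :: real measure" "{0..<int n}"
    by unfold_locales simp
  have "AE x in L n. ennreal (\<rho> n x) = RN_deriv (L n) (marginal_law M X {0..<int n}) x"
    by (rule F.RN_deriv_unique) (simp_all add: marginal_law_eq_density)
  then show ?thesis
    unfolding block_density_def by eventually_elim (metis enn2real_ennreal path_density_nonneg)
qed

text \<open>Along the process the exponents of the normal factors are squared innovations divided by
  twice their variance. Each has expectation 1/2, the source of the summand 1 in
  \<open>ln (2 * pi * (sd k)\<^sup>2) + 1\<close>.\<close>

lemma expectation_ln_path_density:
  "integrable M (\<lambda>x. ln (\<rho> n (\<lambda>j\<in>{0..<int n}. X j x)))"
  "(\<integral>x. ln (\<rho> n (\<lambda>j\<in>{0..<int n}. X j x)) \<partial>M) = - (\<Sum>k\<in>{0..<int n}. (ln (2 * pi * (sd k)\<^sup>2) + 1) / 2)"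
proof -
  have e: "ln (\<rho> n (\<lambda>j\<in>{0..<int n}. X j x)) =
      (\<Sum>k\<in>{0..<int n}. - ln (2 * pi * (sd k)\<^sup>2) / 2 - (innovation k x)\<^sup>2 / (2 * (sd k)\<^sup>2))" for x
  proof -
    let ?y = "\<lambda>j\<in>{0..<int n}. X j x"
    have "ln (\<rho> n ?y) = (\<Sum>k\<in>{0..<int n}. ln (normal_density (prediction r ?y k) (sd k) (?y k)))"
      unfolding path_density_def by (intro ln_prod) (auto, metis less_irrefl normal_density_pos sd_pos)
    also have "\<dots> = (\<Sum>k\<in>{0..<int n}. - ln (2 * pi * (sd k)\<^sup>2) / 2 - (innovation k x)\<^sup>2 / (2 * (sd k)\<^sup>2))"
    proof (rule sum.cong[OF refl])
      fix k assume k: "k \<in> {0..<int n}"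
      then have p: "?y k - prediction r ?y k = innovation k x"
        by (auto simp: innovation_def prediction_def)
      have "0 < 2 * pi * (sd k)\<^sup>2" using sd_pos[of k] by simp
      then show "ln (normal_density (prediction r ?y k) (sd k) (?y k)) =
          - ln (2 * pi * (sd k)\<^sup>2) / 2 - (innovation k x)\<^sup>2 / (2 * (sd k)\<^sup>2)"
        unfolding normal_density_def p by (simp add: ln_mult ln_div ln_sqrt)
    qed
    finally show ?thesis .
  qed
  have i: "integrable M (\<lambda>x. - ln (2 * pi * (sd k)\<^sup>2) / 2 - (innovation k x)\<^sup>2 / (2 * (sd k)\<^sup>2))"
    if "k \<in> {0..<int n}" for k
    using that innovation_square(1)[of k] by simp
  show "integrable M (\<lambda>x. ln (\<rho> n (\<lambda>j\<in>{0..<int n}. X j x)))"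
    unfolding e using i by (rule Bochner_Integration.integrable_sum)
  have "(\<integral>x. ln (\<rho> n (\<lambda>j\<in>{0..<int n}. X j x)) \<partial>M) =
      (\<Sum>k\<in>{0..<int n}. (\<integral>x. - ln (2 * pi * (sd k)\<^sup>2) / 2 - (innovation k x)\<^sup>2 / (2 * (sd k)\<^sup>2) \<partial>M))"
    unfolding e using i by (rule Bochner_Integration.integral_sum)
  also have "\<dots> = (\<Sum>k\<in>{0..<int n}. - ((ln (2 * pi * (sd k)\<^sup>2) + 1) / 2))"
  proof (rule sum.cong[OF refl])
    fix k assume "k \<in> {0..<int n}"
    then have "(\<integral>x. - ln (2 * pi * (sd k)\<^sup>2) / 2 - (innovation k x)\<^sup>2 / (2 * (sd k)\<^sup>2) \<partial>M) =
        - ln (2 * pi * (sd k)\<^sup>2) / 2 - (sd k)\<^sup>2 / (2 * (sd k)\<^sup>2)"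
      using innovation_square[of k] by (simp add: prob_space)
    also have "(sd k)\<^sup>2 / (2 * (sd k)\<^sup>2) = 1 / 2" using sd_pos[of k] by simp
    finally show "(\<integral>x. - ln (2 * pi * (sd k)\<^sup>2) / 2 - (innovation k x)\<^sup>2 / (2 * (sd k)\<^sup>2) \<partial>M) =
        - ((ln (2 * pi * (sd k)\<^sup>2) + 1) / 2)" by (simp add: field_simps)
  qed
  finally show "(\<integral>x. ln (\<rho> n (\<lambda>j\<in>{0..<int n}. X j x)) \<partial>M) = - (\<Sum>k\<in>{0..<int n}. (ln (2 * pi * (sd k)\<^sup>2) + 1) / 2)"
    by (simp add: sum_negf)
qed

text \<open>Since \<open>\<rho> n\<close> is the density of the block law, integrating rho ln rho
  over the block space is taking the expectation of the log-density at the process.\<close>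

lemma block_entropy_eq:
  "block_entropy M X n = ereal (\<Sum>k\<in>{0..<int n}. (ln (2 * pi * (sd k)\<^sup>2) + 1) / 2)"
proof -
  let ?I = "{0..<int n}"
  have sets: "sets (L n) = sets (Pi\<^sub>M ?I (\<lambda>_. borel))" by (simp cong: sets_PiM_cong)
  have X: "(\<lambda>x. \<lambda>j\<in>?I. X j x) \<in> measurable M (Pi\<^sub>M ?I (\<lambda>_. borel))"
    by (intro measurable_restrict) auto
  have ln: "(\<lambda>y. ln (\<rho> n y)) \<in> borel_measurable (Pi\<^sub>M ?I (\<lambda>_. borel))"
    unfolding measurable_cong_sets[OF sets[symmetric] refl] by measurable
  define h where "h = (\<lambda>y. \<rho> n y * ln (\<rho> n y))"
  have h[measurable]: "h \<in> borel_measurable (L n)" unfolding h_def by measurable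
  have ih: "integrable (L n) h"
    using expectation_ln_path_density(1)[of n] integrable_distr_eq[OF X ln]
      integrable_density[of "\<lambda>y. ln (\<rho> n y)" "L n" "\<rho> n"]
    unfolding marginal_law_eq_density[unfolded marginal_law_def] h_def by simp
  have vh: "(\<integral>y. h y \<partial>L n) = - (\<Sum>k\<in>?I. (ln (2 * pi * (sd k)\<^sup>2) + 1) / 2)"
    using expectation_ln_path_density(2)[of n] integral_distr[OF X ln]
      integral_density[of "\<lambda>y. ln (\<rho> n y)" "L n" "\<rho> n"]
    unfolding marginal_law_eq_density[unfolded marginal_law_def] h_def by simp
  have b: "(\<integral>\<^sup>+ x. ennreal (- (block_density M X n x * ln (block_density M X n x))) \<partial>L n) = (\<integral>\<^sup>+ x. ennreal (- h x) \<partial>L n)"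
    "(\<integral>\<^sup>+ x. ennreal (block_density M X n x * ln (block_density M X n x)) \<partial>L n) = (\<integral>\<^sup>+ x. ennreal (h x) \<partial>L n)"
    unfolding h_def using AE_block_density[of n]
    by (auto intro!: nn_integral_cong_AE elim!: eventually_mono)
  \<comment> \<open>Integrability makes both parts finite, so the extended difference in
    \<open>block_entropy\<close> is an ordinary one.\<close>
  obtain p q where pq: "(\<integral>\<^sup>+ x. ennreal (h x) \<partial>L n) = ennreal p" "0 \<le> p"
      "(\<integral>\<^sup>+ x. ennreal (- h x) \<partial>L n) = ennreal q" "0 \<le> q"
    using ih unfolding real_integrable_def by (metis ennreal_cases infinity_ennreal_def)
  then have "(\<integral>y. h y \<partial>L n) = p - q"
    using real_lebesgue_integral_def[OF ih] by simp
  then show ?thesis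
    unfolding block_entropy_def b pq using pq(2,4) vh by (simp add: enn2ereal_ennreal)
qed

lemma shannon_entropy_eq:
  "shannon_entropy M X = ereal ((ln (2 * pi * s\<^sup>2 * (1 - r\<^sup>2)) + 1) / 2)"
proof -
  let ?h = "(ln (2 * pi * s\<^sup>2 * (1 - r\<^sup>2)) + 1) / 2" and ?g = "(ln (2 * pi * s\<^sup>2) + 1) / 2"
  have sum: "(\<Sum>k\<in>{0..<int n}. (ln (2 * pi * (sd k)\<^sup>2) + 1) / 2) = ?g + (real n - 1) * ?h" if "n > 0" for n
    using that
  proof (induction n rule: nat_induct_non_zero)
    case 1 show ?case by (simp add: innovation_sd_def)
  next
    case (Suc n)
    have "(sd (int n))\<^sup>2 = s\<^sup>2 * (1 - r\<^sup>2)"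
      using Suc.hyps r2 by (simp add: innovation_sd_def power_mult_distrib)
    then have "(ln (2 * pi * (sd (int n))\<^sup>2) + 1) / 2 = ?h" by (simp only: mult.assoc)
    moreover have "h + (g + (m - 1) * h) = g + (m + 1 - 1) * h" for g h m :: real
      by (simp add: algebra_simps)
    ultimately show ?case unfolding atLeastLessThan_int_Suc using Suc.IH
      by (simp only: sum.insert finite_atLeastLessThan_int atLeastLessThan_iff less_irrefl simp_thms of_nat_Suc add.commute[of 1])
  qed
  \<comment> \<open>One initial term \<open>?g\<close> and n - 1 terms \<open>?h\<close> average to
    this expression.\<close>
  have "(\<lambda>n. ?h + (?g - ?h) / real n) \<longlonglongrightarrow> ?h + 0"
    by (intro tendsto_add tendsto_const lim_const_over_n)
  then have "(\<lambda>n. ereal (?h + (?g - ?h) / real n)) \<longlonglongrightarrow> ereal ?h" by simp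
  moreover have "\<forall>\<^sub>F n in sequentially. ereal (?h + (?g - ?h) / real n) = block_entropy M X n / ereal (real n)"
    using eventually_gt_at_top[of 0]
  proof eventually_elim
    case (elim n)
    then have "?h + (?g - ?h) / real n = (?g + (real n - 1) * ?h) / real n" by (simp add: field_simps)
    then show ?case using elim by (simp add: block_entropy_eq sum)
  qed
  ultimately have "(\<lambda>n. block_entropy M X n / ereal (real n)) \<longlonglongrightarrow> ereal ?h"
    by (rule Lim_transform_eventually)
  then show ?thesis unfolding shannon_entropy_def by (rule limI)
qed

end

theorem mainTheorem7:
  fixes M :: "'a measure" and N :: "'b measure"
    and X :: "int \<Rightarrow> 'a \<Rightarrow> real" and Y :: "int \<Rightarrow> 'b \<Rightarrow> real"
  assumes "real_process M X" and "real_process N Y"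
    and "stationary M X" and "stationary N Y"
    and "centered M X" and "centered N Y"
    and "gaussian_process M X" and "gaussian_process N Y"
    and "markovian M X" and "markovian N Y"
    and "abs_continuous_marginals M X" and "abs_continuous_marginals N Y"
    and "L2_norm M (X 0) = L2_norm N (Y 0)"
  shows "shannon_entropy M X = shannon_entropy N Y \<longleftrightarrow>
    process_law M X = process_law N Y \<or>
    process_law N Y = process_law M (\<lambda>n \<omega>. (- 1) powi n * X n \<omega>)"
proof -
  obtain r where "gauss_markov M X (L2_norm M (X 0)) r"
    using gauss_markovI assms by metis
  then interpret X: gauss_markov M X "L2_norm M (X 0)" r .
  obtain q where "gauss_markov N Y (L2_norm M (X 0)) q"
    using gauss_markovI assms by metis
  then interpret Y: gauss_markov N Y "L2_norm M (X 0)" q .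
  define s where "s = L2_norm M (X 0)"
  have s: "s > 0" using X.s_pos by (simp add: s_def)
  let ?Z = "\<lambda>n \<omega>. (- 1) powi n * X n \<omega>"
  interpret Z: centered_gaussian M ?Z by (rule X.scale)
  have Zcov: "Z.cov i j = s\<^sup>2 * (- r) ^ nat \<bar>i - j\<bar>" for i j
  proof -
    have "Z.cov i j = (- 1) powi i * (- 1) powi j * X.cov i j"
      unfolding Z.cov_def X.cov_def by (subst integral_mult_right_zero[symmetric]) (simp add: mult.assoc mult.left_commute)
    \<comment> \<open>Both sides depend only on parity, and i + j and i - j have the same
      parity.\<close>
    also have "(- 1) powi i * (- 1) powi j = (- 1 :: real) ^ nat \<bar>i - j\<bar>"
      by (auto simp: minus_one_power_iff)
    finally show ?thesis by (simp add: X.cov_eq s_def power_minus[of r])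
  qed
  \<comment> \<open>The covariance at times 1 and 0 is a functional of the law. As \<open>s\<close>
    is common and positive, it recovers the correlation, and equality of laws gives back
    \<open>r = q\<close> or \<open>q = - r\<close>.\<close>
  have law_cov: "(\<integral>y. y 1 * y 0 \<partial>process_law K W) = (\<integral>x. W 1 x * W 0 x \<partial>K)"
    if "\<And>n. W n \<in> borel_measurable K" for K :: "'c measure" and W
    unfolding process_law_def using that
    by (intro integral_distr measurable_PiM_single') auto
  have law_r: "s\<^sup>2 * r = (\<integral>y. y 1 * y 0 \<partial>process_law M X)"
    using law_cov[OF X.measurable_X] X.cov_eq[of 1 0] by (simp add: X.cov_def s_def)
  have law_q: "s\<^sup>2 * q = (\<integral>y. y 1 * y 0 \<partial>process_law N Y)"
    using law_cov[OF Y.measurable_X] Y.cov_eq[of 1 0] by (simp add: Y.cov_def s_def)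
  have law_Z: "s\<^sup>2 * - r = (\<integral>y. y 1 * y 0 \<partial>process_law M ?Z)"
    using law_cov[OF Z.measurable_X] Zcov[of 1 0] by (simp add: Z.cov_def)
  have pos: "0 < 2 * pi * s\<^sup>2 * (1 - r\<^sup>2)" "0 < 2 * pi * s\<^sup>2 * (1 - q\<^sup>2)"
    using s X.r2 Y.r2 by auto
  have "shannon_entropy M X = shannon_entropy N Y \<longleftrightarrow> r\<^sup>2 = q\<^sup>2"
    unfolding X.shannon_entropy_eq Y.shannon_entropy_eq s_def[symmetric]
    using pos s by (auto simp: ln_inj_iff)
  also have "\<dots> \<longleftrightarrow> r = q \<or> q = - r" by (auto simp: power2_eq_iff)
  also have "r = q \<longleftrightarrow> process_law M X = process_law N Y"
  proof
    assume "r = q"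
    then show "process_law M X = process_law N Y"
      by (intro centered_gaussian_law_eqI X.centered_gaussian_axioms Y.centered_gaussian_axioms)
        (simp add: X.cov_eq Y.cov_eq)
  next
    assume "process_law M X = process_law N Y"
    then have "s\<^sup>2 * r = s\<^sup>2 * q" using law_r law_q by simp
    then show "r = q" using s by simp
  qed
  also have "q = - r \<longleftrightarrow> process_law N Y = process_law M ?Z"
  proof
    assume "q = - r"
    then show "process_law N Y = process_law M ?Z"
      by (intro centered_gaussian_law_eqI Z.centered_gaussian_axioms Y.centered_gaussian_axioms)
        (simp add: Zcov Y.cov_eq s_def)
  next
    assume "process_law N Y = process_law M ?Z"
    then have "s\<^sup>2 * q = s\<^sup>2 * - r" using law_q law_Z by simp
    then show "q = - r" using s by (subst (asm) mult_cancel_left) simp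
  qed
  finally show ?thesis .
qed

end
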